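(* For every integer $k\ge1$, \[ \sum_{r,s,n\ge0}\eta^o_{2k}(r,s,n)a^rb^sq^n=\mathcal{N}^o_{2k}(a,b;q)=\frac{\left(-aq,-bq;q^2\right)_\infty}{\left(q^2,abq^2;q^2\right)_\infty}\sum_{n\in\mathbb{Z}}\frac{\left(-q/a,-q/b;q^2\right)_n(-ab)^nq^{n^2+3n+1+k(2n+1)}}{\left(1-q^{2n+1}\right)^{2k+1}\left(-aq,-bq;q^2\right)_{n+1}}. \]
   Context: For $|q|<1$ and $c\in\mathbb{C}$ let $(c;q)_\infty=\prod_{k\ge0}(1-cq^k)$ and, for every $n\in\mathbb{Z}$, $(c;q)_n=(c;q)_\infty/(cq^n;q)_\infty$; $(c_1,\dots,c_j;q)_n=(c_1;q)_n\cdots(c_j;q)_n$. Define \[ N^o(a,b;z;q):=\sum_{n\ge0}\frac{\left(-q/a,-q/b;q^2\right)_n(ab)^nq^{2n+1}}{\left(zq,q/z;q^2\right)_{n+1}},\qquad \mathcal{N}^o_{2k}(a,b;q):=\frac{1}{(2k)!}\left(\frac{d^{2k}}{dz^{2k}}\,z^kN^o(a,b;z;q)\right)\bigg|_{z=1}. \] A generalized odd Durfee symbol for a positive integer $n$ is a two-rowed array $\begin{pmatrix}a_1&\cdots&a_i\\ b_1&\cdots&b_j\end{pmatrix}_{\lambda,\mu,t}$ where $t\ge0$ is an integer, $\lambda,\mu$ are partitions into distinct odd parts of size at most $2t-1$, each row is a (possibly empty) partition into odd parts of size at most $2t+1$, and $n=\sum a_\ell+\sum b_\ell+|\lambda|+|\mu|+2t+1$.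 An odd number $2x-1$ is missing from such a partition $\nu$ if $1\le x\le t$ and $2x-1$ is not a part of $\nu$. The rank of the symbol is $i-j$. Let $N^o(r,s,m,n)$ be the number of generalized odd Durfee symbols for $n$ with $r$ missing numbers in $\lambda$, $s$ missing numbers in $\mu$, and rank $m$. The $k$th symmetrized rank moment is $\eta^o_k(r,s,n):=\sum_{m\in\mathbb{Z}}\binom{m+\lfloor k/2\rfloor}{k}N^o(r,s,m,n)$, where $\binom{x}{k}=x(x-1)\cdots(x-k+1)/k!$. *)

theory Defs
  imports "HOL-Analysis.Analysis" "HOL-Library.Multiset"
begin

definition qpoch_inf :: "complex \<Rightarrow> complex \<Rightarrow> complex" where
  "qpoch_inf c q = (\<Prod>k. 1 - c * q ^ k)"

text \<open>
  For an integer \<open>n\<close>, the symbol \<open>(c;q)\<^sub>n = (c;q)\<^sub>\<infinity> / (c q\<^sup>n;q)\<^sub>\<infinity>\<close>.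
  When \<open>(c q\<^sup>n;q)\<^sub>\<infinity> = 0\<close> the quotient is read as a meromorphic function of \<open>c\<close>: the
  factors common to both products are cancelled, which is the second branch (for instance
  \<open>(1;q)\<^sub>0 = 1\<close>). At a genuine pole, which needs \<open>n < 0\<close>, the value is \<open>0\<close>, and then
  \<open>1/(c;q)\<^sub>n = 0\<close> is the correct value of the reciprocal. Lemma \<open>qpoch_eq_prod\<close> below
  gives the closed form valid in all cases.
\<close>

definition qpoch :: "complex \<Rightarrow> complex \<Rightarrow> int \<Rightarrow> complex" where
  "qpoch c q n =
     (if qpoch_inf (c * q powi n) q \<noteq> 0 then qpoch_inf c q / qpoch_inf (c * q powi n) q
      else if n \<ge> 0 then (\<Prod>k<nat n. 1 - c * q ^ k)
      else 1 / (\<Prod>k<nat (- n). 1 - c * q powi n * q ^ k))"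

lemma convergent_prod_qpoch_inf:
  fixes c q :: complex
  assumes "norm q < 1"
  shows "convergent_prod (\<lambda>k. 1 - c * q ^ k)"
proof -
  have "summable (\<lambda>k. norm c * norm q ^ k)"
    using assms by (intro summable_mult summable_geometric) simp
  hence "summable (\<lambda>k. norm (- (c * q ^ k)))"
    by (simp add: norm_mult norm_power)
  hence "abs_convergent_prod (\<lambda>k. 1 + - (c * q ^ k))"
    by (subst abs_convergent_prod_conv_summable) simp_all
  thus ?thesis
    by (intro abs_convergent_prod_imp_convergent_prod) simp
qed

lemma qpoch_inf_shift:
  assumes "norm q < 1"
  shows "qpoch_inf c q = (\<Prod>k<m. 1 - c * q ^ k) * qpoch_inf (c * q ^ m) q"
proof (induction m)
  case (Suc m)
  have "qpoch_inf d q = (1 - d) * qpoch_inf (d * q) q" for d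
  proof -
    have 1: "(\<lambda>k. 1 - d * q * q ^ k) has_prod qpoch_inf (d * q) q"
      unfolding qpoch_inf_def using convergent_prod_qpoch_inf[OF assms]
      by (rule convergent_prod_has_prod)
    have 2: "(\<lambda>k. 1 - d * q ^ k) has_prod qpoch_inf d q"
      unfolding qpoch_inf_def using convergent_prod_qpoch_inf[OF assms]
      by (rule convergent_prod_has_prod)
    have "(\<lambda>n. \<Prod>k\<le>n. 1 - d * q * q ^ k) \<longlonglongrightarrow> qpoch_inf (d * q) q"
      using 1 has_prod_imp_tendsto by blast
    hence "(\<lambda>n. (1 - d) * (\<Prod>k\<le>n. 1 - d * q * q ^ k)) \<longlonglongrightarrow> (1 - d) * qpoch_inf (d * q) q"
      by (intro tendsto_intros)
    also have "(\<lambda>n. (1 - d) * (\<Prod>k\<le>n. 1 - d * q * q ^ k)) = (\<lambda>n. \<Prod>k\<le>Suc n. 1 - d * q ^ k)"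
      by (subst prod.atMost_Suc_shift) (simp add: mult_ac)
    finally have "(\<lambda>n. \<Prod>k\<le>Suc n. 1 - d * q ^ k) \<longlonglongrightarrow> (1 - d) * qpoch_inf (d * q) q" .
    moreover have "(\<lambda>n. \<Prod>k\<le>Suc n. 1 - d * q ^ k) \<longlonglongrightarrow> qpoch_inf d q"
      using LIMSEQ_Suc[OF has_prod_imp_tendsto[OF 2]] .
    ultimately show ?thesis
      using LIMSEQ_unique by blast
  qed
  from this[of "c * q ^ m"] Suc show ?case
    by (simp add: mult_ac)
qed simp

lemma qpoch_eq_prod:
  assumes q: "norm q < 1" "q \<noteq> 0"
  shows "qpoch c q n =
           (if n \<ge> 0 then \<Prod>k<nat n. 1 - c * q ^ k
            else 1 / (\<Prod>k<nat (- n). 1 - c * q powi n * q ^ k))"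
proof (cases "qpoch_inf (c * q powi n) q = 0")
  case nz: False
  show ?thesis
  proof (cases "n \<ge> 0")
    case True
    hence "q powi n = q ^ nat n"
      by (simp add: power_int_def)
    with nz True qpoch_inf_shift[OF q(1), of c "nat n"] show ?thesis
      by (simp add: qpoch_def)
  next
    case False
    have "q powi n * q ^ nat (- n) = 1"
      using False q(2) by (simp add: power_int_def field_simps)
    hence "c * q powi n * q ^ nat (- n) = c"
      by (simp add: mult.assoc)
    with nz False qpoch_inf_shift[OF q(1), of "c * q powi n" "nat (- n)"] show ?thesis
      by (auto simp: qpoch_def)
  qed
qed (simp add: qpoch_def)

definition No :: "complex \<Rightarrow> complex \<Rightarrow> complex \<Rightarrow> complex \<Rightarrow> complex" where
  "No a b z q =
     (\<Sum>n. qpoch (- q / a) (q\<^sup>2) (int n) * qpoch (- q / b) (q\<^sup>2) (int n)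
             * (a * b) ^ n * q ^ (2 * n + 1)
           / (qpoch (z * q) (q\<^sup>2) (int n + 1) * qpoch (q / z) (q\<^sup>2) (int n + 1)))"

text \<open>\<open>No_deriv k a b q\<close> is \<open>\<N>\<^sup>o\<close> with subscript \<open>2k\<close>.\<close>

definition No_deriv :: "nat \<Rightarrow> complex \<Rightarrow> complex \<Rightarrow> complex \<Rightarrow> complex" where
  "No_deriv k a b q = (deriv ^^ (2 * k)) (\<lambda>z. z ^ k * No a b z q) 1 / fact (2 * k)"

text \<open>
  The two rows are partitions, i.e. multisets of parts; the partitions \<open>\<lambda>\<close>, \<open>\<mu>\<close> into
  distinct parts are sets of parts. For odd \<open>x\<close>, \<open>x < 2 * t\<close> means \<open>x \<le> 2t - 1\<close>.
\<close>

datatype odd_durfee =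
  Odd_Durfee (top_row: "nat multiset") (bot_row: "nat multiset")
             (lam: "nat set") (mu: "nat set") (bound: nat)

definition odd_durfee_symbols :: "nat \<Rightarrow> odd_durfee set" where
  "odd_durfee_symbols n = {D.
     lam D \<subseteq> {x. odd x \<and> x < 2 * bound D} \<and>
     mu D \<subseteq> {x. odd x \<and> x < 2 * bound D} \<and>
     set_mset (top_row D) \<subseteq> {x. odd x \<and> x \<le> 2 * bound D + 1} \<and>
     set_mset (bot_row D) \<subseteq> {x. odd x \<and> x \<le> 2 * bound D + 1} \<and>
     n = sum_mset (top_row D) + sum_mset (bot_row D) + \<Sum>(lam D) + \<Sum>(mu D) + 2 * bound D + 1}"

definition missing :: "nat \<Rightarrow> nat set \<Rightarrow> nat" where
  "missing t \<nu> = card {x \<in> {1..t}. 2 * x - 1 \<notin> \<nu>}"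

definition durfee_rank :: "odd_durfee \<Rightarrow> int" where
  "durfee_rank D = int (size (top_row D)) - int (size (bot_row D))"

definition durfee_count :: "nat \<Rightarrow> nat \<Rightarrow> int \<Rightarrow> nat \<Rightarrow> nat" where
  "durfee_count r s m n =
     card {D \<in> odd_durfee_symbols n.
             missing (bound D) (lam D) = r \<and> missing (bound D) (mu D) = s \<and> durfee_rank D = m}"

text \<open>The sum over \<open>m\<close> has finite support, see \<open>finite_durfee_count_support\<close> below.\<close>

definition eta :: "nat \<Rightarrow> nat \<Rightarrow> nat \<Rightarrow> nat \<Rightarrow> real" where
  "eta k r s n =
     (\<Sum>\<^sub>\<infinity>m::int. ((real_of_int m + real (k div 2)) gchoose k) * real (durfee_count r s m n))"

lemma finite_odd_durfee_symbols: "finite (odd_durfee_symbols n)"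
proof -
  define M where "M = {A :: nat multiset. set_mset A \<subseteq> {..n} \<and> size A \<le> n}"
  have "M = (\<Union>k\<le>n. {A. set_mset A \<subseteq> {..n} \<and> size A = k})"
    by (auto simp: M_def)
  moreover have "finite {A :: nat multiset. set_mset A \<subseteq> {..n} \<and> size A = k}" for k
  proof -
    have "{A :: nat multiset. set_mset A \<subseteq> {..n} \<and> size A = k}
            \<subseteq> mset ` {xs. set xs \<subseteq> {..n} \<and> length xs = k}"
    proof
      fix A :: "nat multiset" assume A: "A \<in> {A. set_mset A \<subseteq> {..n} \<and> size A = k}"
      obtain xs where "mset xs = A" using ex_mset by blast
      with A show "A \<in> mset ` {xs. set xs \<subseteq> {..n} \<and> length xs = k}" by force
    qed
    thus ?thesis
      using finite_lists_length_eq[of "{..n}" k] finite_surj by blast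
  qed
  ultimately have finM: "finite M" by auto
  have row: "A \<in> M" if "set_mset A \<subseteq> {x. odd x \<and> x \<le> N}" "sum_mset A \<le> n" for A N
  proof -
    have "x \<le> n" if "x \<in># A" for x
      using that \<open>sum_mset A \<le> n\<close> by (auto dest!: multi_member_split)
    moreover have "size A \<le> sum_mset A"
      using that(1)
    proof (induction A)
      case (add x A)
      thus ?case by (cases x) auto
    qed simp
    ultimately show ?thesis using that by (auto simp: M_def)
  qed
  have "odd_durfee_symbols n \<subseteq>
    (\<lambda>(A, B, L, K, t). Odd_Durfee A B L K t) `
      (M \<times> M \<times> Pow {..2 * n} \<times> Pow {..2 * n} \<times> {..n})"
  proof
    fix D assume D: "D \<in> odd_durfee_symbols n"
    obtain A B L K t where [simp]: "D = Odd_Durfee A B L K t" by (cases D)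
    from D have 1: "set_mset A \<subseteq> {x. odd x \<and> x \<le> 2 * t + 1}" "sum_mset A \<le> n"
      "set_mset B \<subseteq> {x. odd x \<and> x \<le> 2 * t + 1}" "sum_mset B \<le> n" "t \<le> n"
      and 2: "L \<subseteq> {x. odd x \<and> x < 2 * t}" "K \<subseteq> {x. odd x \<and> x < 2 * t}"
      by (simp_all add: odd_durfee_symbols_def)
    from 2 \<open>t \<le> n\<close> have "L \<subseteq> {..2 * n}" "K \<subseteq> {..2 * n}" by force+
    with 1 row[OF 1(1,2)] row[OF 1(3,4)]
    have "(A, B, L, K, t) \<in> M \<times> M \<times> Pow {..2 * n} \<times> Pow {..2 * n} \<times> {..n}" by auto
    thus "D \<in> (\<lambda>(A, B, L, K, t). Odd_Durfee A B L K t) `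
      (M \<times> M \<times> Pow {..2 * n} \<times> Pow {..2 * n} \<times> {..n})"
      by (rule rev_image_eqI) simp
  qed
  thus ?thesis
    by (rule finite_subset) (use finM in auto)
qed

lemma finite_durfee_count_support: "finite {m. durfee_count r s m n \<noteq> 0}"
proof (rule finite_subset)
  show "{m. durfee_count r s m n \<noteq> 0} \<subseteq> durfee_rank ` odd_durfee_symbols n"
  proof
    fix m assume "m \<in> {m. durfee_count r s m n \<noteq> 0}"
    hence "{D \<in> odd_durfee_symbols n.
             missing (bound D) (lam D) = r \<and> missing (bound D) (mu D) = s \<and> durfee_rank D = m} \<noteq> {}"
      unfolding durfee_count_def mem_Collect_eq by (rule contrapos_nn) (simp only: card.empty)
    thus "m \<in> durfee_rank ` odd_durfee_symbols n" by blast
  qed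
qed (use finite_odd_durfee_symbols in auto)

end

(*
  The factor D(x, z) = (1 - z x)(1 - x/z) is linear in z + 1/z, so 1/(zq, q/z; q^2)_(n+1) splits into
  partial fractions in the poles x_j = q^(2j+1), with cofactors
  (1 - q^(4j+2)) (-1)^j q^(j^2+j) / ((q^2;q^2)_(n-j) (q^2;q^2)_(n+j+1)).  Collecting the residue at x_j
  turns the sum over n >= j into a 2phi1 that is summed by q-Gauss, and gives N^o as a series of
  (1 - x_j^2)/D(x_j, z) = 1/(1 - z x_j) + x_j/(z - x_j).  Differentiating z^k times these terms 2k times
  yields x_j^k and x_j^(k+1) over (1 - x_j)^(2k+1); these are the terms with indices j and -j-1 of the
  bilateral series.

  For the combinatorial side, a symbol D contributes a^r b^s q^n z^rank(D) to N^o(a,b;z;q), and the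
  2k-th derivative of z^(k+m) at 1 is (2k)! binom(m+k, 2k), which is the weight in the symmetrized moment.
*)
theory Submission
  imports Defs "HOL-Complex_Analysis.Complex_Analysis"
begin

section \<open>Termwise higher derivatives\<close>

text \<open>With u(x) = x + 1/x one has D(x, z) = x (u(x) - u(z)), so the partial fractions are
  Lagrange interpolation of the constant 1 in the variable u(z), and every cofactor is a product of
  values D(x_i, x_j). After the shift n = j + m the q-Gauss parameters satisfy C/(AB) = a b q^2 for
  every j; this argument is where \<open>norm (a * b * q\<^sup>2) < 1\<close> enters. The obstacle
  is analytic: two different expansions of N^o in \<open>z\<close> must be differentiated 2k times
  term by term. Both are therefore majorized uniformly on an annulus 1/R < |z| < R with 1 < R <
  1/|q|, where zq and q/z stay in a disk of radius R |q| < 1. For the poles the majorant is a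
  multiple of |\<open>pole_coeff\<close>|. For the symbols it is the generating function itself,
  taken at |a|, |b|, |q| with both row variables equal to R. The negative bilateral indices come
  from inverting the symbols of negative index, which exchanges \<open>- q / a\<close> with
  \<open>- a * q\<close>.\<close>

lemma abs_summable_on_product:
  fixes f :: "'a \<Rightarrow> 'c :: {real_normed_field, banach}"
  assumes "(\<lambda>x. norm (f x)) summable_on I" "(\<lambda>y. norm (g y)) summable_on J"
  shows "(\<lambda>(x, y). norm (f x * g y)) summable_on I \<times> J"
proof -
  have "(\<lambda>z. case z of (x, y) \<Rightarrow> norm (f x * g y)) summable_on Sigma I (\<lambda>_. J)"
  proof (rule summable_on_SigmaI)
    show "((\<lambda>y. case (x, y) of (x, y) \<Rightarrow> norm (f x * g y)) has_sum
            norm (f x) * (\<Sum>\<^sub>\<infinity>y\<in>J. norm (g y))) J" for x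
      using has_sum_cmult_right[OF has_sum_infsum[OF assms(2)], of "norm (f x)"]
      by (simp add: norm_mult)
    show "(\<lambda>x. norm (f x) * (\<Sum>\<^sub>\<infinity>y\<in>J. norm (g y))) summable_on I"
      by (intro summable_on_cmult_left assms(1))
  qed auto
  thus ?thesis by simp
qed

lemma has_sum_product:
  fixes f :: "'a \<Rightarrow> 'c :: {real_normed_field, banach}"
  assumes "(f has_sum A) I" "(g has_sum B) J"
    and "(\<lambda>x. norm (f x)) summable_on I" "(\<lambda>y. norm (g y)) summable_on J"
  shows "((\<lambda>(x, y). f x * g y) has_sum A * B) (I \<times> J)"
proof (rule has_sum_SigmaI)
  show "((\<lambda>y. case (x, y) of (x, y) \<Rightarrow> f x * g y) has_sum f x * B) J" for x
    using has_sum_cmult_right[OF assms(2), of "f x"] by simp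
  show "((\<lambda>x. f x * B) has_sum A * B) I"
    by (rule has_sum_cmult_left[OF assms(1)])
  show "(\<lambda>(x, y). f x * g y) summable_on I \<times> J"
    by (rule abs_summable_summable)
       (use abs_summable_on_product[OF assms(3,4)] in \<open>simp only: case_prod_unfold\<close>)
qed

text \<open>The M-test makes the finite partial sums converge uniformly on \<open>U\<close> along
  the net of finite subsets, and derivatives of holomorphic functions pass to such limits. Used once
  for the sum over poles and once for the sum over symbols.\<close>

lemma has_sum_higher_deriv:
  fixes f :: "'a \<Rightarrow> complex \<Rightarrow> complex"
  assumes "open U" "z \<in> U"
    and "\<And>i. i \<in> I \<Longrightarrow> f i holomorphic_on U"
    and "\<And>i w. i \<in> I \<Longrightarrow> w \<in> U \<Longrightarrow> norm (f i w) \<le> M i"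
    and "M summable_on I"
    and "\<And>w. w \<in> U \<Longrightarrow> ((\<lambda>i. f i w) has_sum g w) I"
  shows "((\<lambda>i. (deriv ^^ m) (f i) z) has_sum (deriv ^^ m) g z) I"
proof -
  have "uniform_limit U (\<lambda>X w. \<Sum>i\<in>X. f i w) g (finite_subsets_at_top I)"
    by (rule Weierstrass_m_test_general'[OF assms(4,6,5)])
  hence "((\<lambda>X. (deriv ^^ m) (\<lambda>w. \<Sum>i\<in>X. f i w) z) \<longlongrightarrow> (deriv ^^ m) g z) (finite_subsets_at_top I)"
  proof (rule higher_deriv_complex_uniform_limit)
    show "\<forall>\<^sub>F X in finite_subsets_at_top I. (\<lambda>w. \<Sum>i\<in>X. f i w) holomorphic_on U"
      by (rule eventually_finite_subsets_at_top_weakI) (intro holomorphic_on_sum assms(3), auto)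
  qed (use assms(1,2) in auto)
  moreover have "(deriv ^^ m) (\<lambda>w. \<Sum>i\<in>X. f i w) z = (\<Sum>i\<in>X. (deriv ^^ m) (f i) z)"
    if "finite X" "X \<subseteq> I" for X
    using that
  proof (induction X rule: finite_induct)
    case (insert x X)
    thus ?case
      using higher_deriv_add[of "f x" U "\<lambda>w. \<Sum>i\<in>X. f i w" z m] assms(1,2,3)
      by (simp add: holomorphic_on_sum subset_iff)
  qed (induction m, simp_all)
  ultimately show ?thesis
    unfolding has_sum_def
    by (rule Lim_transform_eventually[OF _ eventually_finite_subsets_at_top_weakI])
qed

section \<open>Higher derivatives of powers and of simple poles\<close>

lemma higher_deriv_power_int:
  fixes z :: complex
  assumes "z \<noteq> 0"
  shows "(deriv ^^ j) (\<lambda>w. w powi m) z = fact j * (of_int m gchoose j) * z powi (m - int j)"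
  using assms
proof (induction j arbitrary: z)
  case (Suc j)
  have "(deriv ^^ Suc j) (\<lambda>w. w powi m) z
      = deriv (\<lambda>w. fact j * (of_int m gchoose j) * w powi (m - int j)) z"
    unfolding funpow.simps o_def
  proof (rule deriv_cong_ev)
    show "\<forall>\<^sub>F w in nhds z. (deriv ^^ j) (\<lambda>w. w powi m) w
            = fact j * (of_int m gchoose j) * w powi (m - int j)"
      by (rule eventually_mono[OF eventually_nhds_in_open[of "- {0}" z]]) (use Suc in auto)
  qed auto
  also have "\<dots> = fact j * (of_int m gchoose j) * (of_int (m - int j) * z powi (m - int j - 1))"
    using Suc.prems by (intro DERIV_imp_deriv) (auto intro!: derivative_eq_intros)
  also have "\<dots> = fact (Suc j) * (of_int m gchoose Suc j) * z powi (m - int (Suc j))"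
  proof -
    \<comment> \<open>Absorption for the generalized binomial, which also covers negative
      \<open>m\<close>, as needed for negative ranks.\<close>
    have "(of_int m - of_nat j) * (of_int m gchoose j) = of_nat (Suc j) * (of_int m gchoose Suc j :: complex)"
      by (simp only: gbinomial_absorb_comp gbinomial_absorption)
    moreover have "m - int j - 1 = m - int (Suc j)"
      by simp
    ultimately show ?thesis
      by (simp only: fact_Suc of_int_diff of_int_of_nat_eq) (simp add: mult_ac)
  qed
  finally show ?case .
qed simp

text \<open>Induction on \<open>k\<close> through z^(k+1)/(z - y) = z^k + y z^k/(z - y): in the step
  k < n, so z^k is killed by \<open>n\<close> derivatives and only a factor \<open>y\<close> is
  gained.\<close>

lemma higher_deriv_power_over_linear:
  fixes y :: complex
  assumes "y \<noteq> 1" "k \<le> n"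
  shows "(deriv ^^ n) (\<lambda>z. z ^ k / (z - y)) 1 = fact n * (- 1) ^ n * y ^ k / (1 - y) ^ Suc n"
  using assms(2)
proof (induction k)
  case 0
  have "(deriv ^^ n) (\<lambda>z. (\<lambda>w. w powi (- 1)) (1 * z + (- y))) 1
      = 1 ^ n * (deriv ^^ n) (\<lambda>w. w powi (- 1)) (1 * 1 + (- y))"
    by (rule higher_deriv_compose_linear'[where T = "- {0}" and S = "- {y}"])
       (use assms(1) in \<open>auto intro!: holomorphic_intros\<close>)
  also have "\<dots> = fact n * (- 1) ^ n * (1 - y) powi (- 1 - int n)"
    using assms(1) gbinomial_minus[of "1 :: complex" n]
    by (subst higher_deriv_power_int) (auto simp: binomial_gbinomial[symmetric])
  also have "- 1 - int n = - int (Suc n)"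
    by simp
  also have "(1 - y) powi (- int (Suc n)) = 1 / (1 - y) ^ Suc n"
    by (simp only: power_int_minus power_int_of_nat inverse_eq_divide)
  finally show ?case
    by (simp add: field_simps)
next
  case (Suc k)
  have "(deriv ^^ n) (\<lambda>z. z ^ Suc k / (z - y)) 1
      = (deriv ^^ n) (\<lambda>z. z powi int k + y * (z ^ k / (z - y))) 1"
  proof (rule higher_deriv_cong_ev)
    show "\<forall>\<^sub>F z in nhds 1. z ^ Suc k / (z - y) = z powi int k + y * (z ^ k / (z - y))"
      by (rule eventually_mono[OF eventually_nhds_in_open[of "- {y}" 1]])
         (use assms(1) in \<open>auto simp: field_simps\<close>)
  qed auto
  also have "\<dots> = (deriv ^^ n) (\<lambda>z. z powi int k) 1 + (deriv ^^ n) (\<lambda>z. y * (z ^ k / (z - y))) 1"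
    by (rule higher_deriv_add[where S = "- {0, y}"])
       (use assms(1) in \<open>auto intro!: holomorphic_intros\<close>)
  also have "(deriv ^^ n) (\<lambda>z. z powi int k) (1::complex) = 0"
    using Suc.prems
    by (subst higher_deriv_power_int) (auto simp: binomial_gbinomial[symmetric])
  also have "(deriv ^^ n) (\<lambda>z. y * (z ^ k / (z - y))) 1 = y * (deriv ^^ n) (\<lambda>z. z ^ k / (z - y)) 1"
    by (rule higher_deriv_cmult[where A = "- {y}"])
       (use assms(1) in \<open>auto intro!: holomorphic_intros\<close>)
  finally show ?case
    using Suc by simp
qed

section \<open>The q-Gauss sum\<close>

text \<open>A quotient-free form for natural index, which keeps the case distinctions of
  \<open>qpoch\<close> out of the estimates.\<close>

definition qpoch_fin :: "complex \<Rightarrow> complex \<Rightarrow> nat \<Rightarrow> complex" where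
  "qpoch_fin c p n = (\<Prod>k<n. 1 - c * p ^ k)"

lemma qpoch_fin_0 [simp]: "qpoch_fin c p 0 = 1"
  by (simp add: qpoch_fin_def)

lemma qpoch_fin_Suc: "qpoch_fin c p (Suc n) = qpoch_fin c p n * (1 - c * p ^ n)"
  by (simp add: qpoch_fin_def)

lemma qpoch_fin_add: "qpoch_fin c p (m + n) = qpoch_fin c p m * qpoch_fin (c * p ^ m) p n"
  by (induction n) (simp_all add: qpoch_fin_Suc power_add mult_ac)

lemma qpoch_fin_Suc': "qpoch_fin c p (Suc n) = (1 - c) * qpoch_fin (c * p) p n"
  using qpoch_fin_add[of c p 1 n] by (simp add: qpoch_fin_Suc)

lemma qpoch_inf_split:
  "norm p < 1 \<Longrightarrow> qpoch_inf c p = qpoch_fin c p n * qpoch_inf (c * p ^ n) p"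
  unfolding qpoch_fin_def by (rule qpoch_inf_shift)

lemma qpoch_fin_eq_0_iff: "qpoch_fin c p n = 0 \<longleftrightarrow> (\<exists>k<n. 1 - c * p ^ k = 0)"
  by (auto simp: qpoch_fin_def)

lemma qpoch_fin_tendsto:
  assumes "norm p < 1"
  shows "(\<lambda>n. qpoch_fin c p n) \<longlonglongrightarrow> qpoch_inf c p"
proof -
  have "(\<lambda>n. \<Prod>k\<le>n. 1 - c * p ^ k) \<longlonglongrightarrow> qpoch_inf c p"
    unfolding qpoch_inf_def
    using convergent_prod_has_prod[OF convergent_prod_qpoch_inf[OF assms]]
    by (rule has_prod_imp_tendsto)
  hence "(\<lambda>n. qpoch_fin c p (Suc n)) \<longlonglongrightarrow> qpoch_inf c p"
    by (simp add: qpoch_fin_def lessThan_Suc_atMost)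
  thus ?thesis
    by (rule LIMSEQ_imp_Suc)
qed

lemma qpoch_inf_nonzero:
  assumes "norm p < 1" "\<And>k. 1 - c * p ^ k \<noteq> 0"
  shows "qpoch_inf c p \<noteq> 0"
  unfolding qpoch_inf_def
  using convergent_prod_qpoch_inf[OF assms(1)] assms(2) by (rule prodinf_nonzero)

lemma one_minus_power_nonzero:
  fixes c p :: complex
  assumes "norm p < 1" "norm c < 1"
  shows "1 - c * p ^ k \<noteq> 0"
proof
  assume "1 - c * p ^ k = 0"
  hence "norm c * norm p ^ k = 1"
    by (metis eq_iff_diff_eq_0 norm_mult norm_one norm_power)
  moreover have "norm c * norm p ^ k \<le> norm c * 1"
    using assms by (intro mult_left_mono power_le_one) auto
  ultimately show False
    using assms by simp
qed

lemma qpoch_fin_bounded: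
  assumes "norm p < 1"
  obtains M where "M > 0" "\<And>n. norm (qpoch_fin c p n) \<le> M"
  using convergent_imp_Bseq[OF convergentI[OF qpoch_fin_tendsto[OF assms]], of c] that
  by (auto simp: Bseq_def)

lemma inverse_qpoch_fin_bounded:
  assumes "norm p < 1" "\<And>k. 1 - c * p ^ k \<noteq> 0"
  obtains M where "M > 0" "\<And>n. norm (inverse (qpoch_fin c p n)) \<le> M"
  using convergent_imp_Bseq[OF convergentI[OF tendsto_inverse[OF qpoch_fin_tendsto[OF assms(1)]
     qpoch_inf_nonzero[OF assms]]]] that
  by (auto simp: Bseq_def)

section \<open>The q-Gauss series and its recursion in \<open>C\<close>\<close>

definition gauss_term :: "complex \<Rightarrow> complex \<Rightarrow> complex \<Rightarrow> complex \<Rightarrow> nat \<Rightarrow> complex" where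
  "gauss_term A B C p m =
     qpoch_fin A p m * qpoch_fin B p m / (qpoch_fin p p m * qpoch_fin C p m) * (C / (A * B)) ^ m"

text \<open>Uniformity in the shift \<open>N\<close> is the point: 1/(C p^N; p)_m = (C; p)_N / (C;
  p)_(N+m) is bounded by constants of \<open>C\<close> alone, while the argument of the series
  contributes p^(N m), which makes all terms with m > 0 vanish as \<open>N\<close> grows.\<close>

lemma gauss_term_bound:
  assumes "norm p < 1" "\<And>k. 1 - C * p ^ k \<noteq> 0"
  obtains M where "M > 0"
    "\<And>N m. norm (gauss_term A B (C * p ^ N) p m) \<le> M * norm (C / (A * B)) ^ m * norm p ^ (N * m)"
proof -
  obtain M1 where M1: "M1 > 0" "\<And>n. norm (qpoch_fin A p n) \<le> M1"
    using qpoch_fin_bounded[OF assms(1)] by blast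
  obtain M2 where M2: "M2 > 0" "\<And>n. norm (qpoch_fin B p n) \<le> M2"
    using qpoch_fin_bounded[OF assms(1)] by blast
  obtain M3 where M3: "M3 > 0" "\<And>n. norm (inverse (qpoch_fin p p n)) \<le> M3"
    using inverse_qpoch_fin_bounded[OF assms(1)] one_minus_power_nonzero[OF assms(1,1)] by blast
  obtain M4 where M4: "M4 > 0" "\<And>n. norm (qpoch_fin C p n) \<le> M4"
    using qpoch_fin_bounded[OF assms(1)] by blast
  obtain M5 where M5: "M5 > 0" "\<And>n. norm (inverse (qpoch_fin C p n)) \<le> M5"
    using inverse_qpoch_fin_bounded[OF assms] by blast
  show ?thesis
  proof
    show "M1 * M2 * M3 * (M4 * M5) > 0"
      using M1 M2 M3 M4 M5 by simp
    fix N m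
    have "qpoch_fin C p N \<noteq> 0"
      using assms(2) by (simp add: qpoch_fin_eq_0_iff)
    hence "inverse (qpoch_fin (C * p ^ N) p m) = qpoch_fin C p N * inverse (qpoch_fin C p (N + m))"
      by (simp add: qpoch_fin_add field_simps)
    hence "gauss_term A B (C * p ^ N) p m
        = qpoch_fin A p m * qpoch_fin B p m * inverse (qpoch_fin p p m)
          * (qpoch_fin C p N * inverse (qpoch_fin C p (N + m))) * ((C / (A * B)) ^ m * p ^ (N * m))"
      by (simp add: gauss_term_def divide_inverse power_mult_distrib power_mult mult_ac)
    also have "norm \<dots> \<le> M1 * M2 * M3 * (M4 * M5) * (norm (C / (A * B)) ^ m * norm p ^ (N * m))"
      unfolding norm_mult norm_power
      by (intro mult_mono M1(2) M2(2) M3(2) M4(2) M5(2) order_refl mult_nonneg_nonneg norm_ge_zero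
          zero_le_power M1(1)[THEN less_imp_le] M2(1)[THEN less_imp_le] M3(1)[THEN less_imp_le]
          M4(1)[THEN less_imp_le] M5(1)[THEN less_imp_le])
    finally show "norm (gauss_term A B (C * p ^ N) p m)
      \<le> M1 * M2 * M3 * (M4 * M5) * norm (C / (A * B)) ^ m * norm p ^ (N * m)"
      by (simp add: mult_ac)
  qed
qed

lemma gauss_term_summable:
  assumes "norm p < 1" "\<And>k. 1 - C * p ^ k \<noteq> 0" "norm (C / (A * B)) < 1"
  shows "summable (\<lambda>m. norm (gauss_term A B C p m))"
proof -
  obtain M where M: "\<And>N m. norm (gauss_term A B (C * p ^ N) p m) \<le> M * norm (C / (A * B)) ^ m * norm p ^ (N * m)"
    using gauss_term_bound[OF assms(1,2)] by metis
  show ?thesis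
  proof (rule summable_comparison_test')
    show "summable (\<lambda>m. M * norm (C / (A * B)) ^ m)"
      using assms(3) by (intro summable_mult summable_geometric) simp
    show "norm (norm (gauss_term A B C p m)) \<le> M * norm (C / (A * B)) ^ m" for m
      using M[of 0 m] by simp
  qed
qed

text \<open>A telescoping certificate: with \<open>G m = - (1 - C) (1 - p\<^sup>m) t m\<close> the right-hand side is
  \<open>G (m + 1) - G m\<close>, so summing over \<open>m\<close> gives a recursion from \<open>C\<close> to \<open>C p\<close>.\<close>

lemma gauss_term_contiguous:
  assumes "norm p < 1" "p \<noteq> 0" "A \<noteq> 0" "B \<noteq> 0"
    and C: "\<And>k. 1 - C * p ^ k \<noteq> 0"
  shows "(1 - C) * (1 - C / (A * B)) * gauss_term A B C p m
           - (1 - C / A) * (1 - C / B) * gauss_term A B (C * p) p m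
       = - ((1 - C) * (1 - p ^ Suc m) * gauss_term A B C p (Suc m))
           - (- ((1 - C) * (1 - p ^ m) * gauss_term A B C p m))"
proof -
  define y where "y = p ^ m"
  define t where "t = gauss_term A B C p m"
  have C0: "1 - C \<noteq> 0" "1 - C * y \<noteq> 0"
    using C[of 0] C[of m] by (simp_all add: y_def)
  have py: "1 - p * y \<noteq> 0"
    using one_minus_power_nonzero[OF assms(1,1), of m] by (simp add: y_def)
  have "qpoch_fin (C * p) p m * (1 - C) = qpoch_fin C p m * (1 - C * y)"
    by (metis mult.commute qpoch_fin_Suc qpoch_fin_Suc' y_def)
  hence "qpoch_fin (C * p) p m = qpoch_fin C p m * ((1 - C * y) / (1 - C))"
    using C0 by (simp add: field_simps)
  hence shift: "gauss_term A B (C * p) p m = t * ((1 - C) / (1 - C * y) * y)"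
    by (simp add: gauss_term_def t_def y_def power_divide power_mult_distrib mult_ac)
  have step: "gauss_term A B C p (Suc m)
      = t * ((1 - A * y) * (1 - B * y) / ((1 - p * y) * (1 - C * y)) * (C / (A * B)))"
    by (simp add: gauss_term_def t_def y_def qpoch_fin_Suc mult_ac)
  \<comment> \<open>Once the common factor \<open>t\<close> is removed, the certificate amounts to
    this identity, polynomial in y = p^m; what follows only restores the denominators.\<close>
  have "(1 - C / (A * B)) * (1 - C * y) - (1 - C / A) * (1 - C / B) * y
      = (1 - y) * (1 - C * y) - (1 - A * y) * (1 - B * y) * (C / (A * B))"
    using assms(3,4) by (simp add: field_simps)
  hence "((1 - C / (A * B)) * (1 - C * y) - (1 - C / A) * (1 - C / B) * y) / (1 - C * y)
      = ((1 - y) * (1 - C * y) - (1 - A * y) * (1 - B * y) * (C / (A * B))) / (1 - C * y)"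
    by simp
  hence "1 - C / (A * B) - (1 - C / A) * (1 - C / B) * (y / (1 - C * y))
      = (1 - y) - (1 - A * y) * (1 - B * y) / (1 - C * y) * (C / (A * B))"
    using C0(2) by (simp add: diff_divide_distrib)
  hence "(1 - C) * (1 - C / (A * B) - (1 - C / A) * (1 - C / B) * (y / (1 - C * y)))
      = (1 - C) * ((1 - y) - (1 - A * y) * (1 - B * y) / (1 - C * y) * (C / (A * B)))"
    by simp
  moreover have "(1 - A * y) * (1 - B * y) / (1 - C * y)
      = (1 - p * y) * ((1 - A * y) * (1 - B * y) / ((1 - p * y) * (1 - C * y)))"
    using py by simp
  \<comment> \<open>Bookkeeping with the fractions abstracted to variables, so that no denominator
    has to be multiplied out.\<close>
  moreover have "c * (1 - W) - V * (c * T) = - (c * e * (U' * W)) + c * (1 - y)"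
    if "c * (1 - W - V * T) = c * ((1 - y) - U * W)" "U = e * U'" for c W V T U U' e :: complex
    using that by (simp add: algebra_simps)
  moreover have "(1 - C) / (1 - C * y) * y = (1 - C) * (y / (1 - C * y))"
    by simp
  ultimately have "(1 - C) * (1 - C / (A * B)) - (1 - C / A) * (1 - C / B) * ((1 - C) / (1 - C * y) * y)
      = - ((1 - C) * (1 - p * y) * ((1 - A * y) * (1 - B * y) / ((1 - p * y) * (1 - C * y)) * (C / (A * B))))
        + (1 - C) * (1 - y)"
    by presburger
  hence "t * ((1 - C) * (1 - C / (A * B)) - (1 - C / A) * (1 - C / B) * ((1 - C) / (1 - C * y) * y))
      = t * (- ((1 - C) * (1 - p * y) * ((1 - A * y) * (1 - B * y) / ((1 - p * y) * (1 - C * y)) * (C / (A * B))))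
        + (1 - C) * (1 - y))"
    by simp
  thus ?thesis
    unfolding shift step t_def[symmetric] power_Suc y_def[symmetric]
    by (simp only: right_diff_distrib distrib_left mult_minus_right minus_minus diff_minus_eq_add mult_ac)
qed

text \<open>The certificate telescopes to 0: \<open>G 0\<close> vanishes because of its factor 1 -
  p^0, and \<open>G\<close> tends to 0 because the terms are summable.\<close>

lemma gauss_sum_contiguous:
  assumes "norm p < 1" "p \<noteq> 0" "A \<noteq> 0" "B \<noteq> 0"
    and C: "\<And>k. 1 - C * p ^ k \<noteq> 0" "norm (C / (A * B)) < 1"
  shows "(1 - C) * (1 - C / (A * B)) * (\<Sum>m. gauss_term A B C p m)
       = (1 - C / A) * (1 - C / B) * (\<Sum>m. gauss_term A B (C * p) p m)"
proof -
  have C': "\<And>k. 1 - C * p * p ^ k \<noteq> 0"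
    using C(1)[of "Suc _"] by (simp add: mult_ac)
  have "norm (C * p / (A * B)) = norm (C / (A * B)) * norm p"
    by (simp add: norm_mult norm_divide)
  also have "\<dots> < 1 * 1"
    using assms by (intro mult_strict_mono) auto
  finally have C'': "norm (C * p / (A * B)) < 1"
    by simp
  have s1: "summable (gauss_term A B C p)" "summable (gauss_term A B (C * p) p)"
    using summable_norm_cancel[OF gauss_term_summable[OF assms(1) C]]
      summable_norm_cancel[OF gauss_term_summable[OF assms(1) C' C'']] by auto
  define G where "G m = - ((1 - C) * (1 - p ^ m) * gauss_term A B C p m)" for m
  have "G \<longlonglongrightarrow> - ((1 - C) * (1 - 0) * 0)"
    unfolding G_def using summable_LIMSEQ_zero[OF s1(1)] assms(1)
    by (intro tendsto_intros LIMSEQ_power_zero) auto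
  hence "G \<longlonglongrightarrow> 0"
    by simp
  hence "(\<lambda>m. G (Suc m) - G m) sums (0 - G 0)"
    by (rule telescope_sums)
  hence "(\<lambda>m. G (Suc m) - G m) sums 0"
    by (simp add: G_def)
  moreover have "(\<lambda>m. G (Suc m) - G m) sums
    ((1 - C) * (1 - C / (A * B)) * (\<Sum>m. gauss_term A B C p m)
       - (1 - C / A) * (1 - C / B) * (\<Sum>m. gauss_term A B (C * p) p m))"
    unfolding G_def gauss_term_contiguous[OF assms(1-4) C(1), symmetric]
    by (intro sums_diff sums_mult summable_sums s1)
  ultimately show ?thesis
    using sums_unique2 by force
qed

text \<open>Iterating the step from \<open>C\<close> to \<open>C * p\<close> drives the parameter to
  0, where only the term m = 0 survives; the factors collected on the way become the four infinite
  products.\<close>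

theorem q_gauss_sum:
  assumes "norm p < 1" "p \<noteq> 0" "A \<noteq> 0" "B \<noteq> 0"
    and C: "\<And>k. 1 - C * p ^ k \<noteq> 0" "norm (C / (A * B)) < 1"
  shows "(\<Sum>m. gauss_term A B C p m)
       = qpoch_inf (C / A) p * qpoch_inf (C / B) p / (qpoch_inf C p * qpoch_inf (C / (A * B)) p)"
proof -
  define S where "S N = (\<Sum>m. gauss_term A B (C * p ^ N) p m)" for N
  have C': "1 - C * p ^ N * p ^ k \<noteq> 0" for N k
    using C(1)[of "N + k"] by (simp add: power_add mult_ac)
  have C'': "norm (C * p ^ N / (A * B)) < 1" for N
  proof -
    have "norm (C * p ^ N / (A * B)) = norm (C / (A * B)) * norm p ^ N"
      by (simp add: norm_mult norm_divide norm_power)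
    also have "\<dots> \<le> norm (C / (A * B)) * 1"
      using assms(1) by (intro mult_left_mono power_le_one) auto
    finally show ?thesis
      using C(2) by simp
  qed
  have iter: "qpoch_fin C p N * qpoch_fin (C / (A * B)) p N * S 0
      = qpoch_fin (C / A) p N * qpoch_fin (C / B) p N * S N" for N
  proof (induction N)
    case (Suc N)
    define c where "c = (1 - C * p ^ N) * (1 - C * p ^ N / (A * B))"
    have "qpoch_fin C p (Suc N) * qpoch_fin (C / (A * B)) p (Suc N) * S 0
        = c * (qpoch_fin C p N * qpoch_fin (C / (A * B)) p N * S 0)"
      by (simp add: qpoch_fin_Suc c_def mult_ac)
    also have "\<dots> = qpoch_fin (C / A) p N * qpoch_fin (C / B) p N * (c * S N)"
      unfolding Suc by (simp only: mult_ac)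
    also have "c * S N = (1 - C * p ^ N / A) * (1 - C * p ^ N / B) * S (Suc N)"
      using gauss_sum_contiguous[OF assms(1-4) C' C'', of N]
      by (simp add: S_def c_def mult_ac)
    finally show ?case
      by (simp add: qpoch_fin_Suc mult_ac)
  qed simp
  obtain M where M: "M > 0"
    "\<And>N m. norm (gauss_term A B (C * p ^ N) p m) \<le> M * norm (C / (A * B)) ^ m * norm p ^ (N * m)"
    using gauss_term_bound[OF assms(1) C(1)] by metis
  have "S \<longlonglongrightarrow> 1"
  proof (rule LIM_zero_cancel, rule Lim_null_comparison)
    define r where "r = norm (C / (A * B))"
    show "(\<lambda>N. (M * (\<Sum>m. r ^ m)) * norm p ^ N) \<longlonglongrightarrow> 0"
      using assms(1) by (intro tendsto_mult_right_zero LIMSEQ_power_zero) auto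
    show "\<forall>\<^sub>F N in sequentially. norm (S N - 1) \<le> (M * (\<Sum>m. r ^ m)) * norm p ^ N"
    proof (intro always_eventually allI)
      fix N
      have r: "summable (\<lambda>m. r ^ m)"
        using C(2) unfolding r_def by (intro summable_geometric) simp
      \<comment> \<open>The term m = 0 equals 1. All others carry p^(N m) with N m \<ge> N, so the
        remainder is of order |p|^N.\<close>
      have "(\<lambda>m. gauss_term A B (C * p ^ N) p m - (if m = 0 then 1 else 0)) sums (S N - 1)"
        unfolding S_def
        using summable_norm_cancel[OF gauss_term_summable[OF assms(1) C' C'']] sums_single[of 0 "\<lambda>_. 1 :: complex"]
        by (intro sums_diff summable_sums) auto
      moreover have "norm (gauss_term A B (C * p ^ N) p m - (if m = 0 then 1 else 0)) \<le> M * r ^ m * norm p ^ N" for m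
      proof (cases "m = 0")
        case False
        have "norm (gauss_term A B (C * p ^ N) p m) \<le> M * r ^ m * norm p ^ (N * m)"
          unfolding r_def by (rule M)
        also have "\<dots> \<le> M * r ^ m * norm p ^ N"
          using False M(1) assms(1) by (intro mult_left_mono power_decreasing) (auto simp: r_def)
        finally show ?thesis
          using False by simp
      qed (use M(1) in \<open>simp add: gauss_term_def\<close>)
      moreover have "(\<lambda>m. M * r ^ m * norm p ^ N) sums (M * (\<Sum>m. r ^ m) * norm p ^ N)"
        using r by (intro sums_mult sums_mult2 summable_sums)
      ultimately show "norm (S N - 1) \<le> M * (\<Sum>m. r ^ m) * norm p ^ N"
        by (metis (no_types, lifting) norm_suminf_le sums_summable sums_unique)
    qed
  qed
  have "(\<lambda>N. qpoch_fin C p N * qpoch_fin (C / (A * B)) p N * S 0)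
          \<longlonglongrightarrow> qpoch_inf (C / A) p * qpoch_inf (C / B) p * 1"
    unfolding iter by (intro tendsto_intros qpoch_fin_tendsto assms(1) \<open>S \<longlonglongrightarrow> 1\<close>)
  moreover have "(\<lambda>N. qpoch_fin C p N * qpoch_fin (C / (A * B)) p N * S 0)
          \<longlonglongrightarrow> qpoch_inf C p * qpoch_inf (C / (A * B)) p * S 0"
    by (intro tendsto_intros qpoch_fin_tendsto assms(1))
  ultimately have "qpoch_inf C p * qpoch_inf (C / (A * B)) p * S 0
      = qpoch_inf (C / A) p * qpoch_inf (C / B) p"
    using LIMSEQ_unique by fastforce
  moreover have "qpoch_inf C p \<noteq> 0"
    using qpoch_inf_nonzero[OF assms(1) C(1)] .
  moreover have "qpoch_inf (C / (A * B)) p \<noteq> 0"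
    by (rule qpoch_inf_nonzero[OF assms(1) one_minus_power_nonzero[OF assms(1) C(2)]])
  ultimately show ?thesis
    by (simp add: S_def field_simps)
qed

section \<open>Partial fractions\<close>

definition pole_factor :: "complex \<Rightarrow> complex \<Rightarrow> complex" where
  "pole_factor x z = (1 - z * x) * (1 - x / z)"

text \<open>Interpolation at two nodes: since \<open>pole_factor x z\<close> is x (u(x) - u(z)) with
  u(x) = x + 1/x, the numerator identity \<open>1\<close> only says that the differences of u(x),
  u(y), u(z) add up.\<close>

lemma inverse_pole_factor_mult:
  assumes "x \<noteq> 0" "y \<noteq> 0" "z \<noteq> 0" "pole_factor x y \<noteq> 0" "pole_factor y x \<noteq> 0"
    and "pole_factor x z \<noteq> 0" "pole_factor y z \<noteq> 0"
  shows "1 / (pole_factor x z * pole_factor y z)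
       = 1 / (pole_factor y x * pole_factor x z) + 1 / (pole_factor x y * pole_factor y z)"
proof -
  have 1: "pole_factor x y * pole_factor y z + pole_factor y x * pole_factor x z
      = pole_factor y x * pole_factor x y"
    using assms(1-3) unfolding pole_factor_def by (simp add: field_simps power2_eq_square)
  have "1 / (pole_factor y x * pole_factor x z) + 1 / (pole_factor x y * pole_factor y z)
      = (pole_factor x y * pole_factor y z + pole_factor y x * pole_factor x z)
         / (pole_factor y x * pole_factor x y * (pole_factor x z * pole_factor y z))"
    using assms(4-) by (simp add: add_divide_distrib mult_ac)
  thus ?thesis
    unfolding 1 using assms(4-) by simp
qed

text \<open>The induction keeps \<open>z\<close> arbitrary because the cofactor of a new node is
  found by evaluating the induction hypothesis at that node.\<close>

lemma inverse_prod_pole_factor: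
  assumes "finite J" "J \<noteq> {}" "z \<noteq> 0"
    and "\<And>j. j \<in> J \<Longrightarrow> x j \<noteq> 0" "\<And>j. j \<in> J \<Longrightarrow> pole_factor (x j) z \<noteq> 0"
    and "\<And>i j. i \<in> J \<Longrightarrow> j \<in> J \<Longrightarrow> i \<noteq> j \<Longrightarrow> pole_factor (x i) (x j) \<noteq> 0"
  shows "1 / (\<Prod>j\<in>J. pole_factor (x j) z)
       = (\<Sum>j\<in>J. 1 / ((\<Prod>i\<in>J-{j}. pole_factor (x i) (x j)) * pole_factor (x j) z))"
  using assms
proof (induction J arbitrary: z rule: finite_ne_induct)
  case (insert y J)
  define P where "P j = (\<Prod>i\<in>J-{j}. pole_factor (x i) (x j))" for j
  have IH: "1 / (\<Prod>j\<in>J. pole_factor (x j) w) = (\<Sum>j\<in>J. 1 / (P j * pole_factor (x j) w))"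
    if "w \<noteq> 0" "\<And>j. j \<in> J \<Longrightarrow> pole_factor (x j) w \<noteq> 0" for w
    unfolding P_def using insert.IH[of w] insert.prems that by blast
  have ne: "j \<noteq> y" if "j \<in> J" for j
    using insert that by auto
  have "1 / (\<Prod>j\<in>insert y J. pole_factor (x j) z)
      = (\<Sum>j\<in>J. 1 / (P j * pole_factor (x j) z)) * (1 / pole_factor (x y) z)"
    using insert.hyps insert.prems by (simp add: IH[symmetric])
  also have "\<dots> = (\<Sum>j\<in>J. 1 / P j * (1 / (pole_factor (x j) z * pole_factor (x y) z)))"
    by (simp add: sum_divide_distrib mult_ac)
  also have "\<dots> = (\<Sum>j\<in>J. 1 / (P j * pole_factor (x y) (x j) * pole_factor (x j) z)
       + 1 / (P j * pole_factor (x j) (x y)) * (1 / pole_factor (x y) z))"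
  proof (rule sum.cong[OF refl])
    fix j assume j: "j \<in> J"
    have "1 / (pole_factor (x j) z * pole_factor (x y) z)
       = 1 / (pole_factor (x y) (x j) * pole_factor (x j) z) + 1 / (pole_factor (x j) (x y) * pole_factor (x y) z)"
      using j ne[OF j] insert.prems by (intro inverse_pole_factor_mult) auto
    thus "1 / P j * (1 / (pole_factor (x j) z * pole_factor (x y) z))
       = 1 / (P j * pole_factor (x y) (x j) * pole_factor (x j) z)
       + 1 / (P j * pole_factor (x j) (x y)) * (1 / pole_factor (x y) z)"
      by (simp add: distrib_left mult_ac)
  qed
  \<comment> \<open>The pieces carrying the new pole sum to the induction hypothesis at
    \<open>z = x y\<close>.\<close>
  also have "\<dots> = (\<Sum>j\<in>J. 1 / (P j * pole_factor (x y) (x j) * pole_factor (x j) z))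
       + 1 / (\<Prod>j\<in>J. pole_factor (x j) (x y)) * (1 / pole_factor (x y) z)"
    using insert.prems ne by (subst IH) (auto simp: sum.distrib sum_divide_distrib)
  also have "(\<Sum>j\<in>J. 1 / (P j * pole_factor (x y) (x j) * pole_factor (x j) z))
      = (\<Sum>j\<in>J. 1 / ((\<Prod>i\<in>insert y J-{j}. pole_factor (x i) (x j)) * pole_factor (x j) z))"
  proof (rule sum.cong[OF refl])
    fix j assume j: "j \<in> J"
    have "insert y J - {j} = insert y (J - {j})"
      using ne[OF j] by auto
    thus "1 / (P j * pole_factor (x y) (x j) * pole_factor (x j) z)
       = 1 / ((\<Prod>i\<in>insert y J-{j}. pole_factor (x i) (x j)) * pole_factor (x j) z)"
      using insert.hyps by (simp add: P_def mult_ac)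
  qed
  also have "1 / (\<Prod>j\<in>J. pole_factor (x j) (x y)) * (1 / pole_factor (x y) z)
     = 1 / ((\<Prod>i\<in>insert y J-{y}. pole_factor (x i) (x y)) * pole_factor (x y) z)"
    using insert.hyps by simp
  finally show ?case
    using insert.hyps by (simp add: add.commute)
qed simp

lemma pole_factor_odd_powers:
  assumes "q \<noteq> 0"
  shows "i > j \<Longrightarrow> pole_factor (q ^ (2 * i + 1)) (q ^ (2 * j + 1))
                    = (1 - (q\<^sup>2) ^ (i + j + 1)) * (1 - (q\<^sup>2) ^ (i - j))"
    and "i < j \<Longrightarrow> pole_factor (q ^ (2 * i + 1)) (q ^ (2 * j + 1))
                    = (1 - (q\<^sup>2) ^ (i + j + 1)) * (1 - 1 / (q\<^sup>2) ^ (j - i))"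
proof -
  have e: "q ^ (2 * j + 1) * q ^ (2 * i + 1) = (q\<^sup>2) ^ (i + j + 1)"
    by (simp only: power_add[symmetric] power_mult[symmetric]) (simp add: algebra_simps)
  show "pole_factor (q ^ (2 * i + 1)) (q ^ (2 * j + 1))
                    = (1 - (q\<^sup>2) ^ (i + j + 1)) * (1 - (q\<^sup>2) ^ (i - j))" if "i > j"
  proof -
    have "q ^ (2 * i + 1) / q ^ (2 * j + 1) = (q\<^sup>2) ^ (i - j)"
      using that assms by (simp add: power_diff[symmetric] power_mult[symmetric] diff_mult_distrib2)
    thus ?thesis
      unfolding pole_factor_def e by simp
  qed
  show "pole_factor (q ^ (2 * i + 1)) (q ^ (2 * j + 1))
                    = (1 - (q\<^sup>2) ^ (i + j + 1)) * (1 - 1 / (q\<^sup>2) ^ (j - i))" if "i < j"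
  proof -
    have "2 * j + 1 = 2 * i + 1 + 2 * (j - i)"
      using that by simp
    hence "q ^ (2 * j + 1) = q ^ (2 * i + 1) * (q\<^sup>2) ^ (j - i)"
      by (simp only: power_add power_mult)
    hence "q ^ (2 * i + 1) / q ^ (2 * j + 1) = 1 / (q\<^sup>2) ^ (j - i)"
      using assms by simp
    thus ?thesis
      unfolding pole_factor_def e by simp
  qed
qed

text \<open>Pulling -p^(-i) out of each factor 1 - p^(-i), with p = q^2, leaves (p; p)_j. The signs
  give (-1)^j and the exponents 2 (1 + ... + j) = j^2 + j; this is the origin of the quadratic
  exponent in the cofactors.\<close>

lemma prod_one_minus_inverse_powers:
  fixes q :: complex
  assumes "q \<noteq> 0"
  shows "(\<Prod>i<j. 1 - 1 / (q\<^sup>2) ^ (j - i)) = (- 1) ^ j * qpoch_fin (q\<^sup>2) (q\<^sup>2) j / q ^ (j\<^sup>2 + j)"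
proof -
  have "(\<Prod>i<j. 1 - 1 / (q\<^sup>2) ^ (j - i)) = (\<Prod>i<j. 1 - 1 / (q\<^sup>2) ^ Suc i)"
    by (rule prod.reindex_bij_witness[of _ "\<lambda>i. j - Suc i" "\<lambda>i. j - Suc i"]) (auto simp: Suc_diff_Suc simp del: power_Suc)
  also have "\<dots> = (- 1) ^ j * qpoch_fin (q\<^sup>2) (q\<^sup>2) j / q ^ (j\<^sup>2 + j)"
  proof (induction j)
    case (Suc j)
    have "(Suc j)\<^sup>2 + Suc j = j\<^sup>2 + j + 2 * Suc j"
      by (simp add: power2_eq_square)
    hence "q ^ ((Suc j)\<^sup>2 + Suc j) = q ^ (j\<^sup>2 + j) * (q\<^sup>2) ^ Suc j"
      by (simp only: power_add power_mult)
    moreover define w where "w = 1 - q\<^sup>2 * (q\<^sup>2) ^ j"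
    moreover have "1 - 1 / (q\<^sup>2) ^ Suc j = - w / (q\<^sup>2) ^ Suc j"
      using assms by (simp add: w_def field_simps)
    ultimately show ?case
      by (simp only: prod.lessThan_Suc Suc qpoch_fin_Suc w_def[symmetric]) simp
  qed simp
  finally show ?thesis .
qed

text \<open>The nodes below \<open>j\<close> are handled together in the base case; each node above
  \<open>j\<close> then extends both finite products by one factor.\<close>

lemma prod_pole_factor_odd_powers:
  fixes q :: complex
  assumes "q \<noteq> 0" "norm q < 1" "j \<le> n"
  defines "p \<equiv> q\<^sup>2"
  shows "1 / (\<Prod>i\<in>{..n}-{j}. pole_factor (q ^ (2 * i + 1)) (q ^ (2 * j + 1)))
       = (1 - p ^ (2 * j + 1)) * (- 1) ^ j * q ^ (j\<^sup>2 + j) / (qpoch_fin p p (n - j) * qpoch_fin p p (n + j + 1))"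
  using assms(3)
proof (induction n rule: dec_induct)
  case base
  have np: "norm p < 1"
    using assms(2) by (simp add: p_def norm_power power_less_one_iff)
  have nz: "qpoch_fin p p n \<noteq> 0" "1 - p * p ^ n \<noteq> 0" for n
    using one_minus_power_nonzero[OF np np] by (auto simp: qpoch_fin_eq_0_iff)
  have "{..j} - {j} = {..<j}"
    by auto
  hence "(\<Prod>i\<in>{..j}-{j}. pole_factor (q ^ (2 * i + 1)) (q ^ (2 * j + 1)))
      = (\<Prod>i<j. (1 - p ^ (i + j + 1)) * (1 - 1 / p ^ (j - i)))"
    using pole_factor_odd_powers(2)[OF assms(1)] by (auto simp: p_def intro!: prod.cong)
  also have "\<dots> = (\<Prod>i<j. 1 - p * p ^ j * p ^ i) * (\<Prod>i<j. 1 - 1 / p ^ (j - i))"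
    by (simp add: prod.distrib power_add mult_ac)
  also have "(\<Prod>i<j. 1 - p * p ^ j * p ^ i) = qpoch_fin (p * p ^ j) p j"
    by (simp add: qpoch_fin_def)
  \<comment> \<open>The node i = j is excluded, so the product stops at 1 - p^(2j). Completing it to
    (p; p)_(2j+1) creates the numerator 1 - p^(2j+1) = 1 - x_j^2.\<close>
  also have "\<dots> = qpoch_fin p p (j + j + 1) / (qpoch_fin p p j * (1 - p ^ (2 * j + 1)))"
    using nz(1)[of j] nz(2)[of "2 * j"] qpoch_fin_add[of p p j j]
    by (simp add: qpoch_fin_Suc mult_2)
  also have "(\<Prod>i<j. 1 - 1 / p ^ (j - i)) = (- 1) ^ j * qpoch_fin p p j / q ^ (j\<^sup>2 + j)"
    unfolding p_def by (rule prod_one_minus_inverse_powers[OF assms(1)])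
  finally have "1 / (\<Prod>i\<in>{..j}-{j}. pole_factor (q ^ (2 * i + 1)) (q ^ (2 * j + 1)))
      = (1 - p ^ (2 * j + 1)) * (1 / (- 1) ^ j) * q ^ (j\<^sup>2 + j) / qpoch_fin p p (j + j + 1)"
    using nz(1)[of j] by simp
  moreover have "1 / (- 1) ^ j = ((- 1) ^ j :: complex)"
    by (cases "even j") auto
  ultimately show ?case
    by simp
next
  case (step n)
  have "{..Suc n} - {j} = insert (Suc n) ({..n} - {j})"
    using step by auto
  hence "1 / (\<Prod>i\<in>{..Suc n}-{j}. pole_factor (q ^ (2 * i + 1)) (q ^ (2 * j + 1)))
     = 1 / (\<Prod>i\<in>{..n}-{j}. pole_factor (q ^ (2 * i + 1)) (q ^ (2 * j + 1)))
        / pole_factor (q ^ (2 * Suc n + 1)) (q ^ (2 * j + 1))"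
    by (simp add: mult_ac)
  also have "pole_factor (q ^ (2 * Suc n + 1)) (q ^ (2 * j + 1))
      = (1 - p * p ^ (n + j + 1)) * (1 - p * p ^ (n - j))"
    using step pole_factor_odd_powers(1)[OF assms(1), of j "Suc n"]
    by (simp add: p_def Suc_diff_le)
  finally show ?case
    unfolding step.IH using step by (simp add: Suc_diff_le qpoch_fin_Suc mult_ac)
qed

section \<open>Expansion of \<open>No\<close> over its poles\<close>

lemma qpoch_of_nat:
  assumes "q \<noteq> 0" "norm q < 1"
  shows "qpoch c q (int n) = qpoch_fin c q n"
  by (subst qpoch_eq_prod) (simp_all add: assms qpoch_fin_def)

lemma odd_power_eq: "(x :: 'a :: comm_monoid_mult) ^ (2 * k + 1) = x * (x\<^sup>2) ^ k"
  by (simp only: power_add power_mult power_one_right mult.commute[of _ x])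

lemma prod_pole_factor:
  "(\<Prod>i\<le>n. pole_factor (q ^ (2 * i + 1)) z) = qpoch_fin (z * q) (q\<^sup>2) (Suc n) * qpoch_fin (q / z) (q\<^sup>2) (Suc n)"
  by (simp add: qpoch_fin_def pole_factor_def prod.distrib lessThan_Suc_atMost odd_power_eq mult.assoc
    del: One_nat_def)

text \<open>What q-Gauss leaves at the pole x_j = q^(2j+1): up to the infinite products, the
  coefficient of (1 - x_j^2) / D(x_j, z), free of \<open>z\<close> and \<open>k\<close>.\<close>

definition pole_coeff :: "complex \<Rightarrow> complex \<Rightarrow> complex \<Rightarrow> nat \<Rightarrow> complex" where
  "pole_coeff a b q j =
     qpoch_fin (- q / a) (q\<^sup>2) j * qpoch_fin (- q / b) (q\<^sup>2) j * (- (a * b)) ^ j * q ^ (j\<^sup>2 + 3 * j + 1)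
      / (qpoch_fin (- a * q) (q\<^sup>2) (j + 1) * qpoch_fin (- b * q) (q\<^sup>2) (j + 1))"

lemma norm_one_minus_ge:
  fixes x c :: complex
  assumes "norm x \<le> 1"
  shows "1 - norm c \<le> norm (1 - c * x)"
proof -
  have "norm (c * x) \<le> norm c"
    using mult_left_mono[OF assms, of "norm c"] by (simp add: norm_mult)
  thus ?thesis
    using norm_triangle_ineq2[of 1 "c * x"] by simp
qed

lemma norm_pole_factor_ge:
  assumes "norm q < 1" "norm (z * q) < 1" "norm (q / z) < 1"
  shows "(1 - norm (z * q)) * (1 - norm (q / z)) \<le> norm (pole_factor (q ^ (2 * j + 1)) z)"
proof -
  have "norm (q ^ (2 * j)) \<le> 1"
    using assms(1) by (simp add: norm_power power_le_one)
  hence "(1 - norm (z * q)) * (1 - norm (q / z))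
      \<le> norm (1 - z * q * q ^ (2 * j)) * norm (1 - q / z * q ^ (2 * j))"
    using assms by (intro mult_mono norm_one_minus_ge) auto
  also have "\<dots> = norm (pole_factor (q ^ (2 * j + 1)) z)"
    by (simp add: pole_factor_def norm_mult mult_ac)
  finally show ?thesis .
qed

lemma pole_factor_nonzero:
  assumes "norm q < 1" "norm (z * q) < 1" "norm (q / z) < 1"
  shows "pole_factor (q ^ (2 * j + 1)) z \<noteq> 0"
proof -
  have "0 < (1 - norm (z * q)) * (1 - norm (q / z))"
    using assms by (intro mult_pos_pos) auto
  thus ?thesis
    using norm_pole_factor_ge[OF assms, of j] by auto
qed

text \<open>The interpolation nodes are pairwise distinct, because 0 < |q| < 1 prevents
  \<open>q\<close> from being a root of unity.\<close>

lemma pole_factor_odd_powers_nonzero: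
  assumes "q \<noteq> 0" "norm q < 1" "i \<noteq> j"
  shows "pole_factor (q ^ (2 * i + 1)) (q ^ (2 * j + 1)) \<noteq> 0"
proof -
  have "norm (q\<^sup>2) < 1"
    using assms(2) by (simp add: norm_power power_less_one_iff)
  hence nz: "(q\<^sup>2) ^ n \<noteq> 1" if "n > 0" for n
    using that one_minus_power_nonzero[of "q\<^sup>2" "q\<^sup>2" "n - 1"]
    by (metis Suc_diff_1 eq_iff_diff_eq_0 power_Suc)
  show ?thesis
  proof (cases "i < j")
    case True
    thus ?thesis
      using pole_factor_odd_powers(2)[OF assms(1) True] nz[of "i + j + 1"] nz[of "j - i"] by auto
  next
    case False
    thus ?thesis
      using pole_factor_odd_powers(1)[OF assms(1), of j i] nz[of "i + j + 1"] nz[of "i - j"] assms(3)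
      by auto
  qed
qed

text \<open>One absolutely summable family, indexed by the pole \<open>j\<close> and the excess m =
  n - j, is summed in two orders: fixed \<open>n\<close> recombines the partial fractions into a
  summand of \<open>No\<close>, and fixed \<open>j\<close> is a q-Gauss series.\<close>

theorem No_has_sum_partial_fractions:
  assumes q: "q \<noteq> 0" "norm q < 1" and ab: "a \<noteq> 0" "b \<noteq> 0" "norm (a * b * q\<^sup>2) < 1"
    and nz: "\<And>j. 1 + a * q ^ (2 * j + 1) \<noteq> 0" "\<And>j. 1 + b * q ^ (2 * j + 1) \<noteq> 0"
    and z: "z \<noteq> 0" "norm (z * q) < 1" "norm (q / z) < 1"
  shows "((\<lambda>j. qpoch_inf (- a * q) (q\<^sup>2) * qpoch_inf (- b * q) (q\<^sup>2)
              / (qpoch_inf (q\<^sup>2) (q\<^sup>2) * qpoch_inf (a * b * q\<^sup>2) (q\<^sup>2)) * pole_coeff a b q j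
            * (1 - (q ^ (2 * j + 1))\<^sup>2) / pole_factor (q ^ (2 * j + 1)) z) has_sum No a b z q) UNIV"
proof -
  define p where "p = q\<^sup>2"
  have p: "p \<noteq> 0" "norm p < 1"
    using q by (simp_all add: p_def norm_power power_less_one_iff)
  have pnz: "1 - p * p ^ k \<noteq> 0" for k
    by (rule one_minus_power_nonzero[OF p(2,2)])
  have nz': "1 - (- a * q) * p ^ k \<noteq> 0" "1 - (- b * q) * p ^ k \<noteq> 0" for k
    using nz[of k] unfolding odd_power_eq p_def by (simp_all add: mult.assoc)
  define D where "D j = pole_factor (q ^ (2 * j + 1)) z" for j
  define c where "c n = qpoch_fin (- q / a) p n * qpoch_fin (- q / b) p n * (a * b) ^ n * q ^ (2 * n + 1)" for n
  define e where "e n j = (1 - p ^ (2 * j + 1)) * (- 1) ^ j * q ^ (j\<^sup>2 + j)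
     / (qpoch_fin p p (n - j) * qpoch_fin p p (n + j + 1))" for n j
  define F where "F j m = c (j + m) * e (j + m) j / D j" for j m
  \<comment> \<open>Absorbing q^(2n) isolates the ratio a b q^2, which serves both as geometric rate
    and as argument of the q-Gauss series.\<close>
  have c': "c n = qpoch_fin (- q / a) p n * qpoch_fin (- q / b) p n * (a * b * p) ^ n * q" for n
    unfolding c_def odd_power_eq p_def by (simp add: power_mult_distrib mult_ac)

  have D_ge: "(1 - norm (z * q)) * (1 - norm (q / z)) \<le> norm (D j)" for j
    unfolding D_def by (rule norm_pole_factor_ge[OF q(2) z(2,3)])
  have D_nz: "D j \<noteq> 0" for j
    unfolding D_def by (rule pole_factor_nonzero[OF q(2) z(2,3)])

  define V where "V j = qpoch_inf (- a * q) p * qpoch_inf (- b * q) p / (qpoch_inf p p * qpoch_inf (a * b * p) p)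
      * pole_coeff a b q j * (1 - p ^ (2 * j + 1)) / D j" for j
  have inner: "(\<Sum>m. F j m) = V j" for j
  proof -
    \<comment> \<open>Splitting \<open>j\<close> factors off the numerators and 2j+1 factors off (p;
      p)_(n+j+1) gives these parameters, with C = p^(2j+2); (p; p)_(n-j) is the (p; p)_m of the
      series. The dependence on \<open>j\<close> cancels in C/(AB).\<close>
    define A where "A = - q / a * p ^ j"
    define B where "B = - q / b * p ^ j"
    define C where "C = p * p ^ (2 * j + 1)"
    have A: "A \<noteq> 0" "B \<noteq> 0"
      using q p ab by (simp_all add: A_def B_def)
    have CA: "C / A = - a * q * p ^ (j + 1)" "C / B = - b * q * p ^ (j + 1)" "C / (A * B) = a * b * p"
      using q(1) ab(1,2) by (simp_all add: A_def B_def C_def p_def field_simps power_add[symmetric] power_mult[symmetric] eval_nat_numeral)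
    have C: "1 - C * p ^ k \<noteq> 0" for k
      using pnz[of "2 * j + 1 + k"] by (simp add: C_def power_add mult_ac)
    have F_eq: "F j m = q * (1 - p ^ (2 * j + 1)) * (- 1) ^ j * q ^ (j\<^sup>2 + j) / D j
         * (qpoch_fin (- q / a) p j * qpoch_fin (- q / b) p j * (a * b * p) ^ j / qpoch_fin p p (2 * j + 1))
         * gauss_term A B C p m" for m
    proof -
      have "qpoch_fin p p (j + m + j + 1) = qpoch_fin p p (2 * j + 1) * qpoch_fin C p m"
        using qpoch_fin_add[of p p "2 * j + 1" m] by (simp add: C_def mult_2 add_ac)
      thus ?thesis
        unfolding F_def c' e_def gauss_term_def CA qpoch_fin_add A_def[symmetric] B_def[symmetric]
        by (simp add: power_add mult_ac)
    qed
    have ab': "norm (C / (A * B)) < 1"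
      using ab by (simp add: CA p_def)
    have "(\<Sum>m. F j m) = q * (1 - p ^ (2 * j + 1)) * (- 1) ^ j * q ^ (j\<^sup>2 + j) / D j
         * (qpoch_fin (- q / a) p j * qpoch_fin (- q / b) p j * (a * b * p) ^ j / qpoch_fin p p (2 * j + 1))
         * (\<Sum>m. gauss_term A B C p m)"
      unfolding F_eq
      by (rule suminf_mult[OF summable_norm_cancel[OF gauss_term_summable[OF p(2) C ab']]])
    also have "(\<Sum>m. gauss_term A B C p m)
       = qpoch_inf (- a * q * p ^ (j + 1)) p * qpoch_inf (- b * q * p ^ (j + 1)) p
          / (qpoch_inf C p * qpoch_inf (a * b * p) p)"
      using q_gauss_sum[OF p(2,1) A C ab'] by (simp add: CA)
    also have "qpoch_inf (- a * q * p ^ (j + 1)) p = qpoch_inf (- a * q) p / qpoch_fin (- a * q) p (j + 1)"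
      using qpoch_inf_split[OF p(2), of "- a * q" "j + 1"] nz'(1)
      by (simp add: qpoch_fin_eq_0_iff field_simps)
    also have "qpoch_inf (- b * q * p ^ (j + 1)) p = qpoch_inf (- b * q) p / qpoch_fin (- b * q) p (j + 1)"
      using qpoch_inf_split[OF p(2), of "- b * q" "j + 1"] nz'(2)
      by (simp add: qpoch_fin_eq_0_iff field_simps)
    also have "qpoch_inf C p = qpoch_inf p p / qpoch_fin p p (2 * j + 1)"
      using qpoch_inf_split[OF p(2), of p "2 * j + 1"] pnz
      by (simp add: C_def qpoch_fin_eq_0_iff field_simps)
    also have "q * (1 - p ^ (2 * j + 1)) * (- 1) ^ j * q ^ (j\<^sup>2 + j) / D j
         * (qpoch_fin (- q / a) p j * qpoch_fin (- q / b) p j * (a * b * p) ^ j / qpoch_fin p p (2 * j + 1))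
         * (qpoch_inf (- a * q) p / qpoch_fin (- a * q) p (j + 1) * (qpoch_inf (- b * q) p / qpoch_fin (- b * q) p (j + 1))
          / (qpoch_inf p p / qpoch_fin p p (2 * j + 1) * qpoch_inf (a * b * p) p)) = V j"
    proof -
      have 1: "q ^ (j\<^sup>2 + 3 * j + 1) = q * q ^ (j\<^sup>2 + j) * p ^ j"
        by (simp add: p_def power_mult[symmetric] power_add[symmetric] add_ac)
      have 2: "(- (a * b)) ^ j = (- 1) ^ j * (a * b) ^ j"
        by (rule power_minus)
      have "qpoch_fin p p (2 * j + 1) \<noteq> 0"
        using pnz by (simp only: qpoch_fin_eq_0_iff) blast
      thus ?thesis
        unfolding V_def pole_coeff_def p_def[symmetric] 1 2 by (simp add: power_mult_distrib mult_ac)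
    qed
    finally show ?thesis .
  qed

  have "(\<lambda>(j, m). norm (F j m)) summable_on UNIV \<times> UNIV"
  proof -
    obtain M1 where M1: "M1 > 0" "\<And>n. norm (qpoch_fin (- q / a) p n) \<le> M1"
      using qpoch_fin_bounded[OF p(2)] by blast
    obtain M2 where M2: "M2 > 0" "\<And>n. norm (qpoch_fin (- q / b) p n) \<le> M2"
      using qpoch_fin_bounded[OF p(2)] by blast
    obtain M3 where M3: "M3 > 0" "\<And>n. norm (inverse (qpoch_fin p p n)) \<le> M3"
      using inverse_qpoch_fin_bounded[OF p(2) pnz] by blast
    define \<delta> where "\<delta> = (1 - norm (z * q)) * (1 - norm (q / z))"
    have "\<delta> > 0"
      using z unfolding \<delta>_def by (intro mult_pos_pos) auto
    define r where "r = norm (a * b * p)"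
    have r: "0 \<le> r" "r < 1"
      using ab by (simp_all add: r_def p_def)
    \<comment> \<open>The single power r^(j+m) gives geometric decay in both indices; all other
      factors are bounded uniformly.\<close>
    have bound: "norm (F j m) \<le> (M1 * M2 * (2 * M3 * M3) / \<delta>) * (r ^ j * r ^ m)" for j m
    proof -
      have "norm (c (j + m)) \<le> M1 * M2 * r ^ (j + m) * 1"
        unfolding c' norm_mult norm_power r_def
        using M1 M2 q by (intro mult_mono) auto
      moreover have "norm (e (j + m) j) \<le> 2 * 1 * 1 * (M3 * M3)"
      proof -
        have "norm (1 - p ^ (2 * j + 1)) \<le> norm (1 :: complex) + norm (p ^ (2 * j + 1))"
          by (rule norm_triangle_ineq4)
        also have "norm (p ^ (2 * j + 1)) \<le> 1"
          unfolding norm_power using p by (intro power_le_one) auto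
        finally have "norm (1 - p ^ (2 * j + 1)) \<le> 2"
          by simp
        moreover have "norm q ^ (j\<^sup>2 + j) \<le> 1"
          using q by (intro power_le_one) auto
        moreover have "e (j + m) j = (1 - p ^ (2 * j + 1)) * (- 1) ^ j * q ^ (j\<^sup>2 + j)
           * (inverse (qpoch_fin p p m) * inverse (qpoch_fin p p (j + m + j + 1)))"
          by (simp add: e_def divide_inverse)
        ultimately show ?thesis
          using M3 by (simp only: norm_mult norm_power norm_minus_cancel norm_one power_one) (intro mult_mono, auto)
      qed
      moreover have "inverse (norm (D j)) \<le> inverse \<delta>"
        using \<open>\<delta> > 0\<close> D_ge unfolding \<delta>_def by (intro le_imp_inverse_le) auto
      ultimately have "norm (c (j + m)) * norm (e (j + m) j) * inverse (norm (D j))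
          \<le> M1 * M2 * r ^ (j + m) * 1 * (2 * 1 * 1 * (M3 * M3)) * inverse \<delta>"
        using M1 M2 M3 r \<open>\<delta> > 0\<close> by (intro mult_mono) auto
      thus ?thesis
        by (simp add: F_def norm_mult norm_divide norm_inverse divide_inverse power_add mult_ac)
    qed
    have "(\<lambda>j. r ^ j) summable_on UNIV"
      using r by (intro summable_on_UNIV_nonneg_real_iff[THEN iffD2] summable_geometric) auto
    hence "(\<lambda>(j, m). norm (r ^ j * r ^ m)) summable_on UNIV \<times> UNIV"
      using r by (intro abs_summable_on_product) auto
    hence "(\<lambda>x. (M1 * M2 * (2 * M3 * M3) / \<delta>) * (case x of (j, m) \<Rightarrow> norm (r ^ j * r ^ m))) summable_on UNIV \<times> UNIV"
      by (rule summable_on_cmult_right)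
    thus ?thesis
      by (rule summable_on_comparison_test) (use bound r in \<open>auto simp: abs_mult\<close>)
  qed
  hence abs: "(\<lambda>x. norm (case x of (j, m) \<Rightarrow> F j m)) summable_on UNIV \<times> UNIV"
    by (simp add: case_prod_unfold)
  define T where "T = (\<Sum>\<^sub>\<infinity>(j, m)\<in>UNIV \<times> UNIV. F j m)"
  have sum: "((\<lambda>(j, m). F j m) has_sum T) (UNIV \<times> UNIV)"
    unfolding T_def by (rule has_sum_infsum[OF abs_summable_summable[OF abs]])
  have "(V has_sum T) UNIV"
  proof (rule has_sum_SigmaD[OF sum])
    fix j
    have "(\<lambda>m. F j m) summable_on UNIV"
      using summable_on_SigmaD1[of F UNIV "\<lambda>_. UNIV" j] abs_summable_summable[OF abs] by simp
    hence "((\<lambda>m. F j m) has_sum (\<Sum>\<^sub>\<infinity>m. F j m)) UNIV"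
      by (rule has_sum_infsum)
    moreover from this have "(\<Sum>\<^sub>\<infinity>m. F j m) = V j"
      using has_sum_imp_sums sums_unique inner by metis
    ultimately show "((\<lambda>m. case (j, m) of (j, m) \<Rightarrow> F j m) has_sum V j) UNIV"
      by simp
  qed
  moreover have "T = No a b z q"
  proof -
    \<comment> \<open>With n = j + m the full quadrant becomes the triangle of pairs with j \<le>
      n.\<close>
    have "((\<lambda>(n, j). c n * e n j / D j) has_sum T) (SIGMA n:UNIV. {..n})
        \<longleftrightarrow> ((\<lambda>(j, m). F j m) has_sum T) (UNIV \<times> UNIV)"
      by (rule has_sum_reindex_bij_witness[of _ "\<lambda>(j, m). (j + m, j)" "\<lambda>(n, j). (j, n - j)"])
         (auto simp: F_def)
    with sum have "((\<lambda>(n, j). c n * e n j / D j) has_sum T) (SIGMA n:UNIV. {..n})"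
      by blast
    hence "((\<lambda>n. \<Sum>j\<le>n. c n * e n j / D j) has_sum T) UNIV"
      by (rule has_sum_SigmaD) (auto intro!: has_sum_finite)
    moreover have "(\<Sum>j\<le>n. c n * e n j / D j) = c n / (qpoch_fin (z * q) p (Suc n) * qpoch_fin (q / z) p (Suc n))" for n
    proof -
      have "1 / (\<Prod>j\<le>n. D j) = (\<Sum>j\<le>n. 1 / ((\<Prod>i\<in>{..n}-{j}. pole_factor (q ^ (2 * i + 1)) (q ^ (2 * j + 1))) * D j))"
        unfolding D_def
        using q(1) z(1) pole_factor_nonzero[OF q(2) z(2,3)] pole_factor_odd_powers_nonzero[OF q]
        by (intro inverse_prod_pole_factor) auto
      also have "\<dots> = (\<Sum>j\<le>n. 1 / (\<Prod>i\<in>{..n}-{j}. pole_factor (q ^ (2 * i + 1)) (q ^ (2 * j + 1))) / D j)"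
        by simp
      also have "\<dots> = (\<Sum>j\<le>n. e n j / D j)"
        unfolding e_def p_def by (intro sum.cong refl) (subst prod_pole_factor_odd_powers[OF q], auto)
      also have "(\<Prod>j\<le>n. D j) = qpoch_fin (z * q) p (Suc n) * qpoch_fin (q / z) p (Suc n)"
        unfolding p_def prod_pole_factor[symmetric] by (rule prod.cong[OF refl D_def])
      finally have "c n * (1 / (qpoch_fin (z * q) p (Suc n) * qpoch_fin (q / z) p (Suc n)))
          = c n * (\<Sum>j\<le>n. e n j / D j)"
        by (rule arg_cong)
      thus ?thesis
        by (simp add: sum_distrib_left)
    qed
    ultimately have "((\<lambda>n. c n / (qpoch_fin (z * q) p (Suc n) * qpoch_fin (q / z) p (Suc n))) has_sum T) UNIV"
      by simp
    hence "T = (\<Sum>n. c n / (qpoch_fin (z * q) p (Suc n) * qpoch_fin (q / z) p (Suc n)))"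
      using has_sum_imp_sums sums_unique by blast
    also have "\<dots> = No a b z q"
    proof -
      have "int n + 1 = int (Suc n)" for n
        by simp
      thus ?thesis
        unfolding No_def c_def p_def[symmetric] by (simp only: qpoch_of_nat[OF p])
    qed
    finally show ?thesis .
  qed
  moreover have p_odd: "p ^ (2 * j + 1) = (q ^ (2 * j + 1))\<^sup>2" for j
    by (simp only: p_def flip: power_mult) (simp only: mult.commute)
  ultimately show ?thesis
    unfolding V_def D_def p_odd unfolding p_def by simp
qed

section \<open>Derivatives at 1\<close>

text \<open>For R > 1 an open neighbourhood of 1 that is invariant under inversion, since zq and q/z
  have to be controlled alike.\<close>

definition annulus :: "real \<Rightarrow> complex set" where
  "annulus R = {z. norm z < R \<and> 1 < R * norm z}"

lemma open_annulus: "open (annulus R)"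
  unfolding annulus_def by (intro open_Collect_conj open_Collect_less continuous_intros)

lemma annulus_bounds:
  assumes "z \<in> annulus R" "R > 1"
  shows "z \<noteq> 0" "norm (z * q) \<le> R * norm q" "norm (q / z) \<le> R * norm q"
proof -
  show "z \<noteq> 0"
    using assms by (auto simp: annulus_def)
  show "norm (z * q) \<le> R * norm q"
    using assms by (auto simp: annulus_def norm_mult intro!: mult_right_mono)
  have "inverse (norm z) \<le> R"
    using assms \<open>z \<noteq> 0\<close> by (simp add: annulus_def field_simps)
  thus "norm (q / z) \<le> R * norm q"
    using mult_right_mono[of "inverse (norm z)" R "norm q"] by (simp add: norm_mult norm_inverse divide_inverse mult_ac)
qed

lemma radius_exists:
  assumes "q \<noteq> 0" "norm (q :: complex) < 1"
  obtains R where "R > 1" "R * norm q < 1"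
proof -
  have "1 < 1 / norm q"
    using assms by simp
  then obtain R where "1 < R" "R < 1 / norm q"
    using dense by blast
  thus ?thesis
    using that assms by (simp add: field_simps)
qed

text \<open>The pole at \<open>x\<close> contributes x^(k+1) and the pole at \<open>1 / x\<close>
  contributes x^k. The even order 2k removes the sign (-1)^n of the derivative formula.\<close>

lemma higher_deriv_pole_factor:
  assumes "x \<noteq> 0" "norm x < 1"
  shows "(deriv ^^ (2 * k)) (\<lambda>z. z ^ k * (c * (1 - x\<^sup>2) / pole_factor x z)) 1
       = fact (2 * k) * (c * (x ^ k + x ^ (k + 1)) / (1 - x) ^ (2 * k + 1))"
proof -
  define S where "S = - {0, x, 1 / x}"
  have x1: "x \<noteq> 1"
    using assms(2) by auto
  have S: "open S" "1 \<in> S"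
    using x1 by (auto simp: S_def open_Compl)
  have hol: "(\<lambda>z. z ^ k / (z - y)) holomorphic_on S" if "y = x \<or> y = 1 / x" for y
    using that by (auto intro!: holomorphic_intros simp: S_def)
  have "(deriv ^^ (2 * k)) (\<lambda>z. z ^ k * (c * (1 - x\<^sup>2) / pole_factor x z)) 1
      = (deriv ^^ (2 * k)) (\<lambda>z. (c * x) * (z ^ k / (z - x)) + (- c / x) * (z ^ k / (z - 1 / x))) 1"
  proof (rule higher_deriv_cong_ev)
    have "z ^ k * (c * (1 - x\<^sup>2) / pole_factor x z)
        = (c * x) * (z ^ k / (z - x)) + (- c / x) * (z ^ k / (z - 1 / x))" if "z \<in> S" for z
    proof -
      have nz: "z \<noteq> 0" "z - x \<noteq> 0" "1 - z * x \<noteq> 0"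
        using that assms(1) by (auto simp: S_def field_simps)
      have 1: "z - 1 / x = - (1 - z * x) / x" and 2: "1 - x / z = (z - x) / z"
        using nz(1) assms(1) by (simp_all add: field_simps)
      have "(1 - x\<^sup>2) / pole_factor x z = z * (1 - x\<^sup>2) / ((1 - z * x) * (z - x))"
        unfolding pole_factor_def 2 by simp
      also have "z * (1 - x\<^sup>2) = x * (1 - z * x) + (z - x)"
        by (simp add: algebra_simps power2_eq_square)
      also have "\<dots> / ((1 - z * x) * (z - x)) = x / (z - x) + 1 / (1 - z * x)"
        using nz by (simp add: add_divide_distrib)
      finally have "c * z ^ k * ((1 - x\<^sup>2) / pole_factor x z) = c * z ^ k * (x / (z - x) + 1 / (1 - z * x))"
        by simp
      moreover have "(- c / x) * (z ^ k / (z - 1 / x)) = c * z ^ k * (1 / (1 - z * x))"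
      proof -
        have "(- c / x) * (z ^ k / (- w / x)) = c * z ^ k * (1 / w)" for w
          using assms(1) by simp
        thus ?thesis
          unfolding 1 .
      qed
      ultimately show ?thesis
        by (simp add: distrib_left mult_ac)
    qed
    thus "\<forall>\<^sub>F z in nhds 1. z ^ k * (c * (1 - x\<^sup>2) / pole_factor x z)
        = (c * x) * (z ^ k / (z - x)) + (- c / x) * (z ^ k / (z - 1 / x))"
      by (intro eventually_mono[OF eventually_nhds_in_open[OF S]])
  qed simp
  also have "\<dots> = (deriv ^^ (2 * k)) (\<lambda>z. (c * x) * (z ^ k / (z - x))) 1
                + (deriv ^^ (2 * k)) (\<lambda>z. (- c / x) * (z ^ k / (z - 1 / x))) 1"
    by (rule higher_deriv_add[OF _ _ S]; rule holomorphic_on_mult[OF holomorphic_on_const hol]; simp)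
  also have "(deriv ^^ (2 * k)) (\<lambda>z. (c * x) * (z ^ k / (z - x))) 1
      = (c * x) * (deriv ^^ (2 * k)) (\<lambda>z. z ^ k / (z - x)) 1"
    by (rule higher_deriv_cmult[OF hol S(2,1)]) simp
  also have "(deriv ^^ (2 * k)) (\<lambda>z. (- c / x) * (z ^ k / (z - 1 / x))) 1
      = (- c / x) * (deriv ^^ (2 * k)) (\<lambda>z. z ^ k / (z - 1 / x)) 1"
    by (rule higher_deriv_cmult[OF hol S(2,1)]) simp
  also have "(deriv ^^ (2 * k)) (\<lambda>z. z ^ k / (z - x)) 1 = fact (2 * k) * (x ^ k / (1 - x) ^ (2 * k + 1))"
    using x1 by (subst higher_deriv_power_over_linear) simp_all
  also have "(deriv ^^ (2 * k)) (\<lambda>z. z ^ k / (z - 1 / x)) 1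
      = fact (2 * k) * ((1 / x) ^ k / (1 - 1 / x) ^ (2 * k + 1))"
    using x1 assms(1) by (subst higher_deriv_power_over_linear) simp_all
  \<comment> \<open>The odd exponent 2k+1 yields a minus sign, which cancels the one in
    \<open>- c / x\<close> that came from writing 1/(1 - z x) with its pole at 1/x.\<close>
  also have "(1 / x) ^ k / (1 - 1 / x) ^ (2 * k + 1) = - (x * (x ^ k / (1 - x) ^ (2 * k + 1)))"
  proof -
    have "1 - 1 / x = - ((1 - x) / x)"
      using assms(1) by (simp add: field_simps)
    hence "(1 - 1 / x) ^ (2 * k + 1) = - ((1 - x) ^ (2 * k + 1) / x ^ (2 * k + 1))"
      by (simp only: power_minus_odd odd_two_times_div_two_succ power_divide even_mult_iff odd_add)
         (simp add: power_divide)
    moreover have "x ^ (2 * k + 1) = x * x ^ k * x ^ k"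
      by (simp add: mult_2 power_add)
    ultimately show ?thesis
      using assms(1) by (simp add: power_divide)
  qed
  finally show ?thesis
    using assms(1) by (simp add: distrib_left add_divide_distrib mult_ac)
qed

lemma pole_coeff_summable:
  assumes q: "q \<noteq> 0" "norm q < 1" and ab: "norm (a * b * q\<^sup>2) < 1"
    and nz: "\<And>j. 1 + a * q ^ (2 * j + 1) \<noteq> 0" "\<And>j. 1 + b * q ^ (2 * j + 1) \<noteq> 0"
  shows "(\<lambda>j. norm (pole_coeff a b q j)) summable_on UNIV"
proof -
  define p where "p = q\<^sup>2"
  have p: "norm p < 1"
    using q by (simp_all add: p_def norm_power power_less_one_iff)
  have nz': "1 - (- a * q) * p ^ k \<noteq> 0" "1 - (- b * q) * p ^ k \<noteq> 0" for k
    using nz[of k] unfolding odd_power_eq p_def by (simp_all add: mult.assoc)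
  obtain M1 where M1: "M1 > 0" "\<And>n. norm (qpoch_fin (- q / a) p n) \<le> M1"
    using qpoch_fin_bounded[OF p] by blast
  obtain M2 where M2: "M2 > 0" "\<And>n. norm (qpoch_fin (- q / b) p n) \<le> M2"
    using qpoch_fin_bounded[OF p] by blast
  obtain M3 where M3: "M3 > 0" "\<And>n. norm (inverse (qpoch_fin (- a * q) p n)) \<le> M3"
    using inverse_qpoch_fin_bounded[OF p nz'(1)] by blast
  obtain M4 where M4: "M4 > 0" "\<And>n. norm (inverse (qpoch_fin (- b * q) p n)) \<le> M4"
    using inverse_qpoch_fin_bounded[OF p nz'(2)] by blast
  define r where "r = norm (a * b * p)"
  have "(\<lambda>j. M1 * M2 * M3 * M4 * r ^ j) summable_on UNIV"
    using ab by (intro summable_on_cmult_right summable_on_UNIV_nonneg_real_iff[THEN iffD2] summable_geometric)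
       (auto simp: r_def p_def)
  thus ?thesis
  proof (rule summable_on_comparison_test)
    fix j
    have "pole_coeff a b q j = qpoch_fin (- q / a) p j * qpoch_fin (- q / b) p j
        * inverse (qpoch_fin (- a * q) p (j + 1)) * inverse (qpoch_fin (- b * q) p (j + 1))
        * ((- (a * b)) ^ j * q ^ (j\<^sup>2 + 3 * j + 1))"
      unfolding pole_coeff_def p_def[symmetric] by (simp only: divide_inverse inverse_mult_distrib mult_ac)
    \<comment> \<open>|ab| may exceed 1, so q^(2j) is detached from the quadratic exponent and
      paired with (ab)^j; the rest of the power of \<open>q\<close> is at most 1.\<close>
    also have "(- (a * b)) ^ j * q ^ (j\<^sup>2 + 3 * j + 1) = (- (a * b * p)) ^ j * q ^ (j\<^sup>2 + j + 1)"
    proof -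
      have "j\<^sup>2 + 3 * j + 1 = 2 * j + (j\<^sup>2 + j + 1)"
        by simp
      hence "q ^ (j\<^sup>2 + 3 * j + 1) = p ^ j * q ^ (j\<^sup>2 + j + 1)"
        unfolding p_def power_mult[symmetric] by (metis power_add)
      moreover have "(- (a * b * p)) ^ j = (- (a * b)) ^ j * p ^ j"
        by (simp flip: power_mult_distrib)
      ultimately show ?thesis
        by simp
    qed
    finally have "norm (pole_coeff a b q j) = norm (qpoch_fin (- q / a) p j * qpoch_fin (- q / b) p j
        * inverse (qpoch_fin (- a * q) p (j + 1)) * inverse (qpoch_fin (- b * q) p (j + 1))
        * ((- (a * b * p)) ^ j * q ^ (j\<^sup>2 + j + 1)))"
      by (rule arg_cong)
    also have "\<dots> = norm (qpoch_fin (- q / a) p j) * norm (qpoch_fin (- q / b) p j)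
        * norm (inverse (qpoch_fin (- a * q) p (j + 1))) * norm (inverse (qpoch_fin (- b * q) p (j + 1)))
        * (r ^ j * norm q ^ (j\<^sup>2 + j + 1))"
      unfolding r_def norm_mult norm_power norm_minus_cancel ..
    also have "\<dots> \<le> M1 * M2 * M3 * M4 * (r ^ j * 1)"
      using q by (intro mult_mono M1(2) M2(2) M3(2) M4(2) order_refl mult_nonneg_nonneg norm_ge_zero
          zero_le_power M1(1)[THEN less_imp_le] M2(1)[THEN less_imp_le] M3(1)[THEN less_imp_le]
          M4(1)[THEN less_imp_le] power_le_one) (auto simp: r_def)
    finally show "norm (pole_coeff a b q j) \<le> M1 * M2 * M3 * M4 * r ^ j"
      by simp
  qed auto
qed

text \<open>On the annulus |D(x_j, w)| is at least (1 - R |q|)^2, independently of \<open>j\<close>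
  and \<open>w\<close>, so a constant multiple of |\<open>pole_coeff\<close>| is a majorant and the
  expansion may be differentiated termwise.\<close>

lemma No_deriv_has_sum_pole_coeff:
  assumes q: "q \<noteq> 0" "norm q < 1" and ab: "a \<noteq> 0" "b \<noteq> 0" "norm (a * b * q\<^sup>2) < 1"
    and nz: "\<And>j. 1 + a * q ^ (2 * j + 1) \<noteq> 0" "\<And>j. 1 + b * q ^ (2 * j + 1) \<noteq> 0"
  shows "((\<lambda>j. qpoch_inf (- a * q) (q\<^sup>2) * qpoch_inf (- b * q) (q\<^sup>2)
              / (qpoch_inf (q\<^sup>2) (q\<^sup>2) * qpoch_inf (a * b * q\<^sup>2) (q\<^sup>2)) * pole_coeff a b q j
            * ((q ^ (2 * j + 1)) ^ k + (q ^ (2 * j + 1)) ^ (k + 1)) / (1 - q ^ (2 * j + 1)) ^ (2 * k + 1))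
          has_sum No_deriv k a b q) UNIV"
proof -
  define K where "K = qpoch_inf (- a * q) (q\<^sup>2) * qpoch_inf (- b * q) (q\<^sup>2)
              / (qpoch_inf (q\<^sup>2) (q\<^sup>2) * qpoch_inf (a * b * q\<^sup>2) (q\<^sup>2))"
  define x where "x j = q ^ (2 * j + 1)" for j
  obtain R where R: "R > 1" "R * norm q < 1"
    using radius_exists[OF q] .
  have U: "norm (w * q) < 1" "norm (q / w) < 1" "w \<noteq> 0" if "w \<in> annulus R" for w
    using annulus_bounds[OF that R(1)] R(2) by (auto intro: le_less_trans)
  have x: "norm (x j) < 1" "x j \<noteq> 0" for j
  proof -
    have "norm q ^ (2 * j + 1) < 1"
      unfolding Suc_eq_plus1[symmetric] using q by (intro power_Suc_less_one) auto
    thus "norm (x j) < 1" "x j \<noteq> 0"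
      using q(1) unfolding x_def norm_power by auto
  qed
  define f where "f j z = z ^ k * (K * pole_coeff a b q j * (1 - (x j)\<^sup>2) / pole_factor (x j) z)" for j z
  have "((\<lambda>j. (deriv ^^ (2 * k)) (f j) 1) has_sum (deriv ^^ (2 * k)) (\<lambda>z. z ^ k * No a b z q) 1) UNIV"
  proof (rule has_sum_higher_deriv[OF open_annulus[of R]])
    show "1 \<in> annulus R"
      using R by (simp add: annulus_def)
    show "f j holomorphic_on annulus R" for j
    proof -
      have "pole_factor (x j) w \<noteq> 0" if "w \<in> annulus R" for w
        unfolding x_def by (rule pole_factor_nonzero[OF q(2) U(1,2)[OF that]])
      moreover have "pole_factor (x j) holomorphic_on annulus R"
        unfolding pole_factor_def using U(3) by (intro holomorphic_intros) auto
      ultimately show ?thesis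
        unfolding f_def by (intro holomorphic_intros) auto
    qed
    have \<delta>: "0 < (1 - R * norm q) * (1 - R * norm q)"
      using R by (intro mult_pos_pos) auto
    show "norm (f j w) \<le> R ^ k * (norm K * 2 / ((1 - R * norm q) * (1 - R * norm q))) * norm (pole_coeff a b q j)"
      if "w \<in> annulus R" for j w
    proof -
      have "(1 - R * norm q) * (1 - R * norm q) \<le> (1 - norm (w * q)) * (1 - norm (q / w))"
        using annulus_bounds(2,3)[OF that R(1), of q] R(2) by (intro mult_mono) auto
      also have "\<dots> \<le> norm (pole_factor (x j) w)"
        unfolding x_def by (rule norm_pole_factor_ge[OF q(2) U(1,2)[OF that]])
      finally have 1: "inverse (norm (pole_factor (x j) w)) \<le> inverse ((1 - R * norm q) * (1 - R * norm q))"
        using \<delta> by (intro le_imp_inverse_le) auto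
      have "norm (1 - (x j)\<^sup>2) \<le> norm (1 :: complex) + norm ((x j)\<^sup>2)"
        by (rule norm_triangle_ineq4)
      also have "norm ((x j)\<^sup>2) \<le> 1"
        unfolding norm_power using x(1)[of j] by (intro power_le_one) auto
      finally have 2: "norm (1 - (x j)\<^sup>2) \<le> 2"
        by simp
      have 3: "norm w ^ k \<le> R ^ k"
        using that by (intro power_mono) (auto simp: annulus_def)
      have "norm w ^ k * (norm (K * pole_coeff a b q j) * norm (1 - (x j)\<^sup>2) * inverse (norm (pole_factor (x j) w)))
          \<le> R ^ k * (norm (K * pole_coeff a b q j) * 2 * inverse ((1 - R * norm q) * (1 - R * norm q)))"
        using 1 2 3 R by (intro mult_mono) auto
      thus ?thesis
        by (simp add: f_def norm_mult norm_divide norm_power divide_inverse norm_inverse mult_ac)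
    qed
    show "(\<lambda>j. R ^ k * (norm K * 2 / ((1 - R * norm q) * (1 - R * norm q))) * norm (pole_coeff a b q j)) summable_on UNIV"
      by (intro summable_on_cmult_right pole_coeff_summable[OF q ab(3) nz])
    show "((\<lambda>j. f j w) has_sum w ^ k * No a b w q) UNIV" if "w \<in> annulus R" for w
      unfolding f_def x_def K_def
      by (intro has_sum_cmult_right No_has_sum_partial_fractions[OF q ab nz] U[OF that])
  qed
  hence "((\<lambda>j. (deriv ^^ (2 * k)) (f j) 1 * inverse (fact (2 * k))) has_sum
      (deriv ^^ (2 * k)) (\<lambda>z. z ^ k * No a b z q) 1 * inverse (fact (2 * k))) UNIV"
    by (rule has_sum_cmult_left)
  moreover have "(deriv ^^ (2 * k)) (f j) 1 * inverse (fact (2 * k))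
     = K * pole_coeff a b q j * (x j ^ k + x j ^ (k + 1)) / (1 - x j) ^ (2 * k + 1)" for j
    unfolding f_def higher_deriv_pole_factor[OF x(2,1)] by (simp add: divide_inverse mult_ac)
  ultimately show ?thesis
    by (simp only: No_deriv_def divide_inverse K_def x_def)
qed

section \<open>The bilateral series\<close>

text \<open>Reverse the order of the factors and use 1 + 1/(a q^(2i+1)) = (1 + a q^(2i+1)) / (a
  q^(2i+1)). The exponents add up to 1 + 3 + ... + (2n-1) = n^2.\<close>

lemma qpoch_minus_of_nat:
  assumes "a \<noteq> 0" "q \<noteq> 0" "norm q < 1"
  shows "qpoch (- q / a) (q\<^sup>2) (- int n) = a ^ n * q ^ n\<^sup>2 / qpoch_fin (- a * q) (q\<^sup>2) n"
proof -
  have p: "q\<^sup>2 \<noteq> 0" "norm (q\<^sup>2) < 1"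
    using assms by (simp_all add: norm_power power_less_one_iff)
  have "qpoch (- q / a) (q\<^sup>2) (- int n) = 1 / (\<Prod>k<n. 1 - (- q / a) * (q\<^sup>2) powi (- int n) * (q\<^sup>2) ^ k)"
    by (subst qpoch_eq_prod[OF p(2,1)]) auto
  also have "(\<Prod>k<n. 1 - (- q / a) * (q\<^sup>2) powi (- int n) * (q\<^sup>2) ^ k)
      = (\<Prod>i<n. (1 - (- a * q) * (q\<^sup>2) ^ i) / (a * q ^ (2 * i + 1)))"
  proof (rule prod.reindex_bij_witness[of _ "\<lambda>i. n - Suc i" "\<lambda>i. n - Suc i"])
    fix k assume k: "k \<in> {..<n}"
    define i where "i = n - Suc k"
    have n: "n = Suc (i + k)"
      using k by (simp add: i_def)
    have "(- q / a) * (q\<^sup>2) powi (- int n) * (q\<^sup>2) ^ k = - 1 / (a * q ^ (2 * i + 1))"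
      unfolding odd_power_eq n power_int_minus power_int_of_nat using assms
      by (simp add: power_add field_simps power2_eq_square)
    moreover have "(1 - (- a * q) * (q\<^sup>2) ^ i) / (a * q ^ (2 * i + 1)) = 1 - (- 1 / (a * q ^ (2 * i + 1)))"
      unfolding odd_power_eq using assms by (simp add: field_simps)
    ultimately show "(1 - (- a * q) * (q\<^sup>2) ^ (n - Suc k)) / (a * q ^ (2 * (n - Suc k) + 1))
        = 1 - (- q / a) * (q\<^sup>2) powi (- int n) * (q\<^sup>2) ^ k"
      by (simp only: i_def)
  qed auto
  also have "\<dots> = qpoch_fin (- a * q) (q\<^sup>2) n / (\<Prod>i<n. a * q ^ (2 * i + 1))"
    by (simp add: qpoch_fin_def prod_dividef)
  also have "(\<Prod>i<n. a * q ^ (2 * i + 1)) = a ^ n * q ^ n\<^sup>2"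
  proof (induction n)
    case (Suc n)
    have "(Suc n)\<^sup>2 = n\<^sup>2 + (2 * n + 1)"
      by (simp add: power2_eq_square)
    hence "q ^ (Suc n)\<^sup>2 = q ^ n\<^sup>2 * q ^ (2 * n + 1)"
      by (simp only: power_add)
    thus ?case
      using Suc by simp
  qed simp
  finally show ?thesis
    by simp
qed

definition bilateral_term :: "nat \<Rightarrow> complex \<Rightarrow> complex \<Rightarrow> complex \<Rightarrow> int \<Rightarrow> complex" where
  "bilateral_term k a b q n = qpoch (- q / a) (q\<^sup>2) n * qpoch (- q / b) (q\<^sup>2) n
              * (- (a * b)) powi n * q powi (n\<^sup>2 + 3 * n + 1 + int k * (2 * n + 1))
            / ((1 - q powi (2 * n + 1)) ^ (2 * k + 1)
               * (qpoch (- a * q) (q\<^sup>2) (n + 1) * qpoch (- b * q) (q\<^sup>2) (n + 1)))"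

lemma bilateral_term_nonneg:
  assumes "q \<noteq> 0" "norm q < 1"
  shows "bilateral_term k a b q (int j)
       = pole_coeff a b q j * (q ^ (2 * j + 1)) ^ k / (1 - q ^ (2 * j + 1)) ^ (2 * k + 1)"
proof -
  have p: "q\<^sup>2 \<noteq> 0" "norm (q\<^sup>2) < 1"
    using assms by (simp_all add: norm_power power_less_one_iff)
  have e: "int j + 1 = int (j + 1)" "2 * int j + 1 = int (2 * j + 1)"
    "(int j)\<^sup>2 + 3 * int j + 1 + int k * int (2 * j + 1) = int (j\<^sup>2 + 3 * j + 1 + (2 * j + 1) * k)"
    by (simp_all add: algebra_simps)
  show ?thesis
    unfolding bilateral_term_def pole_coeff_def e qpoch_of_nat[OF p] power_int_of_nat
      power_add[of q "j\<^sup>2 + 3 * j + 1"] power_mult[of q "2 * j + 1" k]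
    by (simp add: mult_ac)
qed

text \<open>The reflection n = -j-1 changes the sign of 2n+1, and inversion exchanges the numerator
  symbols with those of the denominator. Compared with the term at \<open>j\<close>, exactly one
  extra factor x = q^(2j+1) remains.\<close>

lemma bilateral_term_negative:
  assumes q: "q \<noteq> 0" "norm q < 1" and "a \<noteq> 0" "b \<noteq> 0"
  shows "bilateral_term k a b q (- int j - 1)
       = pole_coeff a b q j * (q ^ (2 * j + 1)) ^ (k + 1) / (1 - q ^ (2 * j + 1)) ^ (2 * k + 1)"
proof -
  define x where "x = q ^ (2 * j + 1)"
  define w where "w = q ^ j\<^sup>2"
  define Q where "Q = q ^ (j\<^sup>2 + 3 * j + 1)"
  define s where "s = (- 1 :: complex) ^ j"
  have nz: "x \<noteq> 0" "w \<noteq> 0" "Q \<noteq> 0" "s \<noteq> 0"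
    using q by (simp_all add: x_def w_def Q_def s_def)
  have s2: "s * s = 1"
    by (simp add: s_def flip: power_mult_distrib)
  have sq: "q ^ (j + 1)\<^sup>2 = w * x"
  proof -
    have "(j + 1)\<^sup>2 = j\<^sup>2 + (2 * j + 1)"
      by (simp add: power2_eq_square)
    thus ?thesis
      by (simp only: w_def x_def power_add)
  qed
  have 1: "qpoch (- q / c) (q\<^sup>2) (- int j - 1) = c ^ (j + 1) * (w * x) / qpoch_fin (- c * q) (q\<^sup>2) (j + 1)"
    if "c \<noteq> 0" for c
  proof -
    have "- int j - 1 = - int (j + 1)"
      by simp
    thus ?thesis
      using qpoch_minus_of_nat[OF that q, of "j + 1"] unfolding sq by (simp only:)
  qed
  \<comment> \<open>the same inversion formula with \<open>1 / c\<close> for \<open>c\<close>; both sides are 0 at a pole of \<open>qpoch\<close>\<close>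
  have 2: "1 / qpoch (- c * q) (q\<^sup>2) (- int j - 1 + 1) = c ^ j * qpoch_fin (- q / c) (q\<^sup>2) j / w"
    if "c \<noteq> 0" for c
    using qpoch_minus_of_nat[of "1 / c" q j] that q by (simp add: w_def power_divide mult_ac)
  have 3: "(- (a * b)) powi (- int j - 1) = - s / (a ^ (j + 1) * b ^ (j + 1))"
  proof -
    have "- int j - 1 = - int (j + 1)"
      by simp
    hence "(- (a * b)) powi (- int j - 1) = 1 / (- (a * b)) ^ (j + 1)"
      by (simp only: power_int_minus power_int_of_nat inverse_eq_divide)
    also have "(- (a * b)) ^ (j + 1) = - s * (a ^ (j + 1) * b ^ (j + 1))"
      by (subst power_minus) (simp add: s_def power_mult_distrib mult_ac)
    also have "1 / \<dots> = - (s * s) / (s * (a ^ (j + 1) * b ^ (j + 1)))"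
      by (simp add: s2)
    finally show ?thesis
      using nz by simp
  qed
  have 4: "q powi ((- int j - 1)\<^sup>2 + 3 * (- int j - 1) + 1 + int k * (2 * (- int j - 1) + 1)) = Q / (x * x * x ^ k)"
  proof -
    have pd: "q powi (int m - int n) = q ^ m / q ^ n" for m n
      using q(1) by (simp add: power_int_diff)
    \<comment> \<open>Without the part in \<open>k\<close> the exponent is j^2 - j - 1 = (j^2 + 3j +
      1) - 2 (2j + 1), which exhibits the exponent of \<open>pole_coeff\<close>.\<close>
    have idx: "(- int j - 1)\<^sup>2 + 3 * (- int j - 1) + 1 + int k * (2 * (- int j - 1) + 1)
        = int (j\<^sup>2 + 3 * j + 1) - int ((2 * j + 1) + (2 * j + 1) + (2 * j + 1) * k)"
      by (simp add: power2_eq_square algebra_simps)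
    show ?thesis
      unfolding idx pd Q_def x_def by (simp only: power_add power_mult)
  qed
  \<comment> \<open>The minus sign from the odd exponent cancels the one produced by the power of
    -(ab) in \<open>3\<close>.\<close>
  have 5: "1 / (1 - q powi (2 * (- int j - 1) + 1)) ^ (2 * k + 1) = - (x * x ^ k * x ^ k / (1 - x) ^ (2 * k + 1))"
  proof -
    have "2 * (- int j - 1) + 1 = - int (2 * j + 1)"
      by simp
    hence "1 - q powi (2 * (- int j - 1) + 1) = - ((1 - x) / x)"
      using nz by (simp only: power_int_minus power_int_of_nat x_def) (simp add: field_simps)
    hence "(1 - q powi (2 * (- int j - 1) + 1)) ^ (2 * k + 1) = - ((1 - x) ^ (2 * k + 1) / x ^ (2 * k + 1))"
      by (simp only: power_minus_odd odd_two_times_div_two_succ power_divide even_mult_iff odd_add)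
         (simp add: power_divide)
    moreover have "x ^ (2 * k + 1) = x * x ^ k * x ^ k"
      by (simp add: mult_2 power_add)
    ultimately show ?thesis
      by simp
  qed
  have "bilateral_term k a b q (- int j - 1)
      = qpoch (- q / a) (q\<^sup>2) (- int j - 1) * qpoch (- q / b) (q\<^sup>2) (- int j - 1)
         * (- (a * b)) powi (- int j - 1)
         * q powi ((- int j - 1)\<^sup>2 + 3 * (- int j - 1) + 1 + int k * (2 * (- int j - 1) + 1))
         * (1 / (1 - q powi (2 * (- int j - 1) + 1)) ^ (2 * k + 1))
         * (1 / qpoch (- a * q) (q\<^sup>2) (- int j - 1 + 1)) * (1 / qpoch (- b * q) (q\<^sup>2) (- int j - 1 + 1))"
    unfolding bilateral_term_def by (simp only: divide_inverse inverse_mult_distrib mult_1 mult_ac)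
  also have "\<dots> = a ^ (j + 1) * (w * x) / qpoch_fin (- a * q) (q\<^sup>2) (j + 1)
       * (b ^ (j + 1) * (w * x) / qpoch_fin (- b * q) (q\<^sup>2) (j + 1))
       * (- s / (a ^ (j + 1) * b ^ (j + 1))) * (Q / (x * x * x ^ k))
       * - (x * x ^ k * x ^ k / (1 - x) ^ (2 * k + 1))
       * (a ^ j * qpoch_fin (- q / a) (q\<^sup>2) j / w) * (b ^ j * qpoch_fin (- q / b) (q\<^sup>2) j / w)"
    unfolding 1[OF assms(3)] 1[OF assms(4)] 2[OF assms(3)] 2[OF assms(4)] 3 4 5 ..
  also have "\<dots> = pole_coeff a b q j * x ^ (k + 1) / (1 - x) ^ (2 * k + 1)"
  proof -
    have ab: "(- (a * b)) ^ j = s * (a ^ j * b ^ j)"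
      by (subst power_minus) (simp add: s_def power_mult_distrib)
    define A B where "A = a ^ j" and "B = b ^ j"
    have "A \<noteq> 0" "B \<noteq> 0"
      using assms by (simp_all add: A_def B_def)
    thus ?thesis
      unfolding pole_coeff_def ab Q_def[symmetric]
      unfolding power_add power_one_right A_def[symmetric] B_def[symmetric]
      using nz assms(3,4) by (simp add: mult_ac)
  qed
  finally show ?thesis
    by (simp only: x_def)
qed

lemma has_sum_int_split:
  fixes f :: "int \<Rightarrow> 'a :: topological_comm_monoid_add"
  assumes "((\<lambda>j. f (int j)) has_sum A) UNIV" "((\<lambda>j. f (- int j - 1)) has_sum B) UNIV"
  shows "(f has_sum (A + B)) UNIV"
proof -
  have "(f has_sum A) (range int)"
    using assms(1) by (subst has_sum_reindex) (simp_all add: o_def)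
  moreover have "(f has_sum B) (range (\<lambda>j. - int j - 1))"
    using assms(2) by (subst has_sum_reindex) (simp_all add: o_def inj_def)
  ultimately have "(f has_sum (A + B)) (range int \<union> range (\<lambda>j. - int j - 1))"
    by (rule has_sum_Un_disjoint) auto
  moreover have "n \<in> range int \<union> range (\<lambda>j. - int j - 1)" for n
  proof (cases "n \<ge> 0")
    case True
    thus ?thesis
      by (metis UnI1 rangeI zero_le_imp_eq_int)
  next
    case False
    hence "n = - int (nat (- n - 1)) - 1"
      by simp
    thus ?thesis
      by blast
  qed
  ultimately show ?thesis
    by (metis UNIV_eq_I)
qed

text \<open>Pairing \<open>j\<close> with -j-1 reproduces the two summands of the pole series.
  Summability of each half comes first, since the infinite sum of a family that is not summable
  would default to 0.\<close>

theorem No_deriv_bilateral: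
  assumes q: "q \<noteq> 0" "norm q < 1" and ab: "a \<noteq> 0" "b \<noteq> 0" "norm (a * b * q\<^sup>2) < 1"
    and nz: "\<And>j. 1 + a * q ^ (2 * j + 1) \<noteq> 0" "\<And>j. 1 + b * q ^ (2 * j + 1) \<noteq> 0"
  shows "bilateral_term k a b q summable_on UNIV"
    and "No_deriv k a b q = qpoch_inf (- a * q) (q\<^sup>2) * qpoch_inf (- b * q) (q\<^sup>2)
              / (qpoch_inf (q\<^sup>2) (q\<^sup>2) * qpoch_inf (a * b * q\<^sup>2) (q\<^sup>2)) * (\<Sum>\<^sub>\<infinity>n. bilateral_term k a b q n)"
proof -
  define K where "K = qpoch_inf (- a * q) (q\<^sup>2) * qpoch_inf (- b * q) (q\<^sup>2)
              / (qpoch_inf (q\<^sup>2) (q\<^sup>2) * qpoch_inf (a * b * q\<^sup>2) (q\<^sup>2))"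
  define x where "x j = q ^ (2 * j + 1)" for j
  \<comment> \<open>Used with m = k for the indices \<open>j\<close> and with m = k+1 for the
    indices -j-1.\<close>
  have sum: "(\<lambda>j. pole_coeff a b q j * x j ^ m / (1 - x j) ^ (2 * k + 1)) summable_on UNIV" for m
  proof (rule abs_summable_summable, rule summable_on_comparison_test)
    show "(\<lambda>j. inverse ((1 - norm q) ^ (2 * k + 1)) * norm (pole_coeff a b q j)) summable_on UNIV"
      by (intro summable_on_cmult_right pole_coeff_summable[OF q ab(3) nz])
    fix j
    have q2: "norm (q ^ (2 * j)) \<le> 1"
      using q by (simp add: norm_power power_le_one)
    have "1 - norm q \<le> norm (1 - x j)"
      using norm_one_minus_ge[OF q2, of q] by (simp add: x_def)
    hence "inverse (norm (1 - x j) ^ (2 * k + 1)) \<le> inverse ((1 - norm q) ^ (2 * k + 1))"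
      using q by (intro le_imp_inverse_le power_mono) auto
    moreover have "norm (x j) ^ m \<le> 1"
      unfolding x_def norm_power using q by (intro power_le_one) auto
    ultimately have "inverse (norm (1 - x j) ^ (2 * k + 1)) * (norm (pole_coeff a b q j) * norm (x j) ^ m)
        \<le> inverse ((1 - norm q) ^ (2 * k + 1)) * (norm (pole_coeff a b q j) * 1)"
      using q by (intro mult_mono) auto
    thus "norm (pole_coeff a b q j * x j ^ m / (1 - x j) ^ (2 * k + 1))
        \<le> inverse ((1 - norm q) ^ (2 * k + 1)) * norm (pole_coeff a b q j)"
      by (simp add: norm_mult norm_divide norm_power norm_inverse divide_inverse mult_ac)
  qed auto
  obtain S1 S2 where S: "((\<lambda>j. bilateral_term k a b q (int j)) has_sum S1) UNIV"
    "((\<lambda>j. bilateral_term k a b q (- int j - 1)) has_sum S2) UNIV"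
    unfolding bilateral_term_nonneg[OF q] bilateral_term_negative[OF q ab(1,2)]
    using sum[of k] sum[of "k + 1"] unfolding x_def summable_on_def by blast
  have total: "(bilateral_term k a b q has_sum (S1 + S2)) UNIV"
    by (rule has_sum_int_split[OF S])
  thus "bilateral_term k a b q summable_on UNIV"
    by (rule has_sum_imp_summable)
  have "((\<lambda>j. K * (bilateral_term k a b q (int j) + bilateral_term k a b q (- int j - 1)))
          has_sum K * (S1 + S2)) UNIV"
    by (intro has_sum_cmult_right has_sum_add S)
  also have "(\<lambda>j. K * (bilateral_term k a b q (int j) + bilateral_term k a b q (- int j - 1)))
     = (\<lambda>j. K * pole_coeff a b q j * (x j ^ k + x j ^ (k + 1)) / (1 - x j) ^ (2 * k + 1))"
    unfolding bilateral_term_nonneg[OF q] bilateral_term_negative[OF q ab(1,2)] x_def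
    by (simp add: fun_eq_iff distrib_left add_divide_distrib mult_ac)
  finally have "K * (S1 + S2) = No_deriv k a b q"
    using No_deriv_has_sum_pole_coeff[OF q ab nz, of k] unfolding K_def x_def
    by (rule has_sum_unique)
  thus "No_deriv k a b q = K * (\<Sum>\<^sub>\<infinity>n. bilateral_term k a b q n)"
    using total by (simp add: infsumI)
qed

section \<open>Generalized odd Durfee symbols\<close>

lemma prod_odd_less: "(\<Prod>x | odd x \<and> x < 2 * t. f x) = (\<Prod>i<t. f (2 * i + 1))" for t :: nat
  by (rule prod.reindex_bij_witness[of _ "\<lambda>i. 2 * i + 1" "\<lambda>x. x div 2"]) (auto elim!: oddE)

lemma prod_odd_le: "(\<Prod>x | odd x \<and> x \<le> 2 * t + 1. f x) = (\<Prod>i\<le>t. f (2 * i + 1))" for t :: nat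
  by (rule prod.reindex_bij_witness[of _ "\<lambda>i. 2 * i + 1" "\<lambda>x. x div 2"]) (auto elim!: oddE)

lemma missing_eq_card:
  assumes "\<nu> \<subseteq> {x. odd x \<and> x < 2 * t}"
  shows "missing t \<nu> = card ({x. odd x \<and> x < 2 * t} - \<nu>)"
  unfolding missing_def
  by (rule bij_betw_same_card[of "\<lambda>x. 2 * x - 1"], rule bij_betwI[where g = "\<lambda>x. (x + 1) div 2"])
     (auto elim!: oddE)

text \<open>Expand the product: from each factor, an odd number contributes its power of
  \<open>q\<close> if it is a part and \<open>a\<close> if it is missing.\<close>

lemma distinct_odd_parts_gf:
  fixes a q :: "'a :: comm_semiring_1"
  shows "(\<Sum>\<nu>\<in>Pow {x. odd x \<and> x < 2 * t}. a ^ missing t \<nu> * q ^ \<Sum>\<nu>) = (\<Prod>i<t. a + q ^ (2 * i + 1))"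
proof -
  define S where "S = {x. odd x \<and> x < 2 * t}"
  have "finite S"
    by (rule finite_subset[of _ "{..<2 * t}"]) (auto simp: S_def)
  have "(\<Prod>i<t. a + q ^ (2 * i + 1)) = (\<Prod>x\<in>S. q ^ x + a)"
    unfolding S_def prod_odd_less by (simp add: add.commute)
  also have "\<dots> = (\<Sum>\<nu>\<in>Pow S. (\<Prod>x\<in>\<nu>. q ^ x) * (\<Prod>x\<in>S-\<nu>. a))"
    by (rule prod_add[OF \<open>finite S\<close>])
  also have "\<dots> = (\<Sum>\<nu>\<in>Pow S. a ^ missing t \<nu> * q ^ \<Sum>\<nu>)"
    by (intro sum.cong refl) (auto simp: missing_eq_card S_def power_sum mult.commute)
  finally show ?thesis
    by (simp add: S_def)
qed

text \<open>Splitting off the multiplicity of one element leaves a geometric series times the same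
  family over a smaller set. The two conclusions go through the induction together because
  multiplying the sums requires absolute summability.\<close>

lemma has_sum_prod_mset:
  fixes w :: "'b \<Rightarrow> 'a :: {real_normed_field, banach}"
  assumes "finite S" "\<And>x. x \<in> S \<Longrightarrow> norm (w x) < 1"
  shows "((\<lambda>A. \<Prod>x\<in>#A. w x) has_sum (\<Prod>x\<in>S. 1 / (1 - w x))) {A. set_mset A \<subseteq> S}
       \<and> (\<lambda>A. norm (\<Prod>x\<in>#A. w x)) summable_on {A. set_mset A \<subseteq> S}"
  using assms
proof (induction S rule: finite_induct)
  case empty
  have "{A. set_mset A \<subseteq> {}} = {{#} :: 'b multiset}"
    by auto
  thus ?case
    by (auto intro!: has_sum_finiteI)
next
  case (insert y S)
  define f where "f A = (\<Prod>x\<in>#A. w x)" for A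
  define M where "M = {A. set_mset A \<subseteq> S}"
  have y: "norm (w y) < 1"
    using insert.prems by simp
  have geo_abs: "summable (\<lambda>n. norm (w y ^ n))"
    using y by (simp add: norm_power summable_geometric)
  have geo: "((\<lambda>n. w y ^ n) has_sum 1 / (1 - w y)) UNIV" "(\<lambda>n. norm (w y ^ n)) summable_on UNIV"
    using norm_summable_imp_has_sum[OF geo_abs geometric_sums[OF y]] geo_abs
    by (auto simp: summable_on_UNIV_nonneg_real_iff)
  have IH: "(f has_sum (\<Prod>x\<in>S. 1 / (1 - w x))) M" "(\<lambda>A. norm (f A)) summable_on M"
    using insert by (auto simp: f_def[abs_def] M_def)
  define i :: "'b multiset \<Rightarrow> nat \<times> 'b multiset" where "i A = (count A y, filter_mset (\<lambda>x. x \<noteq> y) A)" for A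
  define j where "j = (\<lambda>(n, A). replicate_mset n y + A)"
  have ij: "j (i A) = A" for A
    by (rule multiset_eqI) (auto simp: i_def j_def)
  have ji: "i (j z) = z" "j z \<in> {A. set_mset A \<subseteq> insert y S}" if "z \<in> UNIV \<times> M" for z
  proof -
    obtain n A where z: "z = (n, A)" "A \<in> M"
      using \<open>z \<in> UNIV \<times> M\<close> by auto
    have "y \<notin># A"
      using z insert.hyps by (auto simp: M_def)
    thus "i (j z) = z"
      by (auto simp: z i_def j_def not_in_iff intro!: multiset_eqI)
    show "j z \<in> {A. set_mset A \<subseteq> insert y S}"
      using z by (auto simp: j_def M_def)
  qed
  have i: "i A \<in> UNIV \<times> M" if "A \<in> {A. set_mset A \<subseteq> insert y S}" for A
    using that by (auto simp: i_def M_def)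
  have f: "(case z of (n, A) \<Rightarrow> w y ^ n * f A) = f (j z)" for z
    by (simp add: f_def j_def case_prod_unfold)
  have "((\<lambda>(n, A). w y ^ n * f A) has_sum 1 / (1 - w y) * (\<Prod>x\<in>S. 1 / (1 - w x))) (UNIV \<times> M)"
    by (rule has_sum_product[OF geo(1) IH(1) geo(2) IH(2)])
  also have "?this \<longleftrightarrow> (f has_sum (\<Prod>x\<in>insert y S. 1 / (1 - w x))) {A. set_mset A \<subseteq> insert y S}"
    by (rule has_sum_reindex_bij_witness[of _ i j]) (use i ji ij f insert.hyps in auto)
  finally have 1: "(f has_sum (\<Prod>x\<in>insert y S. 1 / (1 - w x))) {A. set_mset A \<subseteq> insert y S}" .
  have "(\<lambda>(n, A). norm (w y ^ n * f A)) summable_on (UNIV \<times> M)"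
    by (rule abs_summable_on_product[OF geo(2) IH(2)])
  also have "?this \<longleftrightarrow> (\<lambda>A. norm (f A)) summable_on {A. set_mset A \<subseteq> insert y S}"
    by (rule summable_on_reindex_bij_witness[of _ i j]) (use i ji ij f in \<open>auto simp: case_prod_unfold\<close>)
  finally show ?case
    using 1 by (simp add: f_def[abs_def])
qed

lemma odd_parts_gf:
  fixes z q :: "'a :: {real_normed_field, banach}"
  assumes "norm q < 1" "norm (z * q) < 1"
  shows "((\<lambda>A. z ^ size A * q ^ sum_mset A) has_sum (1 / (\<Prod>i\<le>t. 1 - z * q ^ (2 * i + 1))))
           {A. set_mset A \<subseteq> {x. odd x \<and> x \<le> 2 * t + 1}}"
    and "(\<lambda>A. norm (z ^ size A * q ^ sum_mset A)) summable_on {A. set_mset A \<subseteq> {x. odd x \<and> x \<le> 2 * t + 1}}"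
proof -
  define S where "S = {x. odd x \<and> x \<le> 2 * t + 1}"
  have "finite S"
    by (rule finite_subset[of _ "{..2 * t + 1}"]) (auto simp: S_def)
  moreover have "norm (z * q ^ x) < 1" if x: "x \<in> S" for x
  proof -
    \<comment> \<open>Parts are odd, hence positive, so one factor \<open>q\<close> can stay with
      \<open>z\<close>; |z| alone may exceed 1.\<close>
    obtain i where "x = Suc i"
      using x by (cases x) (auto simp: S_def)
    hence "norm (z * q ^ x) = norm (z * q) * norm q ^ i"
      by (simp add: norm_mult norm_power)
    also have "\<dots> \<le> norm (z * q) * 1"
      using assms by (intro mult_left_mono power_le_one) auto
    finally show ?thesis
      using assms by simp
  qed
  moreover have "(\<Prod>x\<in>#A. z * q ^ x) = z ^ size A * q ^ sum_mset A" for A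
    by (induction A) (simp_all add: power_add mult_ac)
  moreover have "(\<Prod>x\<in>S. 1 / (1 - z * q ^ x)) = 1 / (\<Prod>i\<le>t. 1 - z * q ^ (2 * i + 1))"
    unfolding S_def prod_odd_le by (simp add: prod_dividef)
  ultimately show "((\<lambda>A. z ^ size A * q ^ sum_mset A) has_sum (1 / (\<Prod>i\<le>t. 1 - z * q ^ (2 * i + 1))))
           {A. set_mset A \<subseteq> {x. odd x \<and> x \<le> 2 * t + 1}}"
    and "(\<lambda>A. norm (z ^ size A * q ^ sum_mset A)) summable_on {A. set_mset A \<subseteq> {x. odd x \<and> x \<le> 2 * t + 1}}"
    using has_sum_prod_mset[of S "\<lambda>x. z * q ^ x"] by (simp_all add: S_def)
qed

section \<open>Symbols of a fixed bound and their generating function\<close>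

definition durfee_level :: "nat \<Rightarrow> odd_durfee set" where
  "durfee_level t = {D. bound D = t \<and>
     lam D \<subseteq> {x. odd x \<and> x < 2 * t} \<and> mu D \<subseteq> {x. odd x \<and> x < 2 * t} \<and>
     set_mset (top_row D) \<subseteq> {x. odd x \<and> x \<le> 2 * t + 1} \<and>
     set_mset (bot_row D) \<subseteq> {x. odd x \<and> x \<le> 2 * t + 1}}"

definition durfee_size :: "odd_durfee \<Rightarrow> nat" where
  "durfee_size D = sum_mset (top_row D) + sum_mset (bot_row D) + \<Sum>(lam D) + \<Sum>(mu D) + 2 * bound D + 1"

definition durfee_monomial :: "'a :: comm_semiring_1 \<Rightarrow> 'a \<Rightarrow> 'a \<Rightarrow> odd_durfee \<Rightarrow> 'a" where
  "durfee_monomial a b q D = a ^ missing (bound D) (lam D) * b ^ missing (bound D) (mu D) * q ^ durfee_size D"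

text \<open>The rows have separate variables so that \<open>z' = 1 / z\<close> records the rank
  while \<open>z = z' = R\<close> gives a majorant; the generic type admits complex and real
  arguments.\<close>

definition durfee_weight :: "'a :: comm_semiring_1 \<Rightarrow> 'a \<Rightarrow> 'a \<Rightarrow> 'a \<Rightarrow> 'a \<Rightarrow> odd_durfee \<Rightarrow> 'a" where
  "durfee_weight a b z z' q D = durfee_monomial a b q D * (z ^ size (top_row D) * z' ^ size (bot_row D))"

definition level_gf :: "'a :: field \<Rightarrow> 'a \<Rightarrow> 'a \<Rightarrow> 'a \<Rightarrow> 'a \<Rightarrow> nat \<Rightarrow> 'a" where
  "level_gf a b z z' q t = q ^ (2 * t + 1)
     * ((\<Prod>i<t. a + q ^ (2 * i + 1)) * (\<Prod>i<t. b + q ^ (2 * i + 1))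
        * (1 / (\<Prod>i\<le>t. 1 - z * q ^ (2 * i + 1)) * (1 / (\<Prod>i\<le>t. 1 - z' * q ^ (2 * i + 1)))))"

lemma odd_durfee_symbols_eq:
  "odd_durfee_symbols n = {D \<in> (\<Union>t. durfee_level t). durfee_size D = n}"
  by (auto simp: odd_durfee_symbols_def durfee_level_def durfee_size_def)

text \<open>Once \<open>t\<close> is fixed, the two sets and the two rows vary independently, so the
  sum factors into four generating functions.\<close>

lemma durfee_level_has_sum:
  fixes a b z z' q :: "'a :: {real_normed_field, banach}"
  assumes "norm q < 1" "norm (z * q) < 1" "norm (z' * q) < 1"
  shows "(durfee_weight a b z z' q has_sum level_gf a b z z' q t) (durfee_level t)"
proof -
  define P where "P = Pow {x. odd x \<and> x < 2 * t}"
  define M where "M = {A. set_mset A \<subseteq> {x. odd x \<and> x \<le> 2 * t + 1}}"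
  have "finite P"
    unfolding P_def finite_Pow_iff by (rule finite_subset[of _ "{..<2 * t}"]) auto
  define f where "f c \<nu> = c ^ missing t \<nu> * q ^ \<Sum>\<nu>" for c \<nu>
  define g where "g c A = c ^ size A * q ^ sum_mset A" for c A
  have f: "(f c has_sum (\<Prod>i<t. c + q ^ (2 * i + 1))) P" "(\<lambda>\<nu>. norm (f c \<nu>)) summable_on P" for c
    using \<open>finite P\<close> distinct_odd_parts_gf[of c t q] by (auto intro!: has_sum_finiteI simp: f_def P_def)
  have g: "(g c has_sum 1 / (\<Prod>i\<le>t. 1 - c * q ^ (2 * i + 1))) M" "(\<lambda>A. norm (g c A)) summable_on M"
    if "norm (c * q) < 1" for c
    using odd_parts_gf[OF assms(1) that] unfolding g_def M_def by blast+
  have "((\<lambda>(x, y). (case x of (l, m) \<Rightarrow> f a l * f b m) * (case y of (A, B) \<Rightarrow> g z A * g z' B)) has_sum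
      ((\<Prod>i<t. a + q ^ (2 * i + 1)) * (\<Prod>i<t. b + q ^ (2 * i + 1))
        * (1 / (\<Prod>i\<le>t. 1 - z * q ^ (2 * i + 1)) * (1 / (\<Prod>i\<le>t. 1 - z' * q ^ (2 * i + 1))))))
      ((P \<times> P) \<times> (M \<times> M))"
  proof (intro has_sum_product)
    show "(\<lambda>x. norm (case x of (l, m) \<Rightarrow> f a l * f b m)) summable_on P \<times> P"
      using abs_summable_on_product[OF f(2) f(2)] by (simp add: case_prod_unfold)
    show "(\<lambda>y. norm (case y of (A, B) \<Rightarrow> g z A * g z' B)) summable_on M \<times> M"
      using abs_summable_on_product[OF g(2)[OF assms(2)] g(2)[OF assms(3)]] by (simp add: case_prod_unfold)
  qed (use f g assms in auto)
  hence "((\<lambda>w. q ^ (2 * t + 1) * (case w of (x, y) \<Rightarrow>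
          (case x of (l, m) \<Rightarrow> f a l * f b m) * (case y of (A, B) \<Rightarrow> g z A * g z' B)))
      has_sum level_gf a b z z' q t) ((P \<times> P) \<times> (M \<times> M))"
    unfolding level_gf_def by (rule has_sum_cmult_right)
  also have "?this \<longleftrightarrow> ?thesis"
    by (rule has_sum_reindex_bij_witness[of _ "\<lambda>D. ((lam D, mu D), (top_row D, bot_row D))"
          "\<lambda>((l, m), (A, B)). Odd_Durfee A B l m t"])
       (auto simp: durfee_level_def P_def M_def f_def g_def durfee_weight_def durfee_monomial_def
         durfee_size_def power_add mult_ac)
  finally show ?thesis .
qed

lemma prod_plus_odd_powers:
  assumes "a \<noteq> 0"
  shows "(\<Prod>i<t. a + q ^ (2 * i + 1)) = a ^ t * qpoch_fin (- q / a) (q\<^sup>2) t"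
proof -
  have "a + q ^ (2 * i + 1) = a * (1 - (- q / a) * (q\<^sup>2) ^ i)" for i
    unfolding odd_power_eq using assms by (simp add: field_simps)
  thus ?thesis
    by (simp add: qpoch_fin_def prod.distrib)
qed

lemma prod_one_minus_odd_powers:
  "(\<Prod>i\<le>t. 1 - z * q ^ (2 * i + 1)) = qpoch_fin (z * q) (q\<^sup>2) (Suc t)"
  unfolding odd_power_eq by (simp add: qpoch_fin_def lessThan_Suc_atMost mult.assoc)

lemma level_gf_eq:
  fixes a b z z' q :: complex
  assumes "a \<noteq> 0" "b \<noteq> 0"
  shows "level_gf a b z z' q t = qpoch_fin (- q / a) (q\<^sup>2) t * qpoch_fin (- q / b) (q\<^sup>2) t
             * (a * b) ^ t * q ^ (2 * t + 1)
           / (qpoch_fin (z * q) (q\<^sup>2) (Suc t) * qpoch_fin (z' * q) (q\<^sup>2) (Suc t))"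
  unfolding level_gf_def prod_plus_odd_powers[OF assms(1)] prod_plus_odd_powers[OF assms(2)]
    prod_one_minus_odd_powers
  by (simp add: power_mult_distrib mult_ac)

text \<open>The factor (a b q^2)^t carries the decay; the finite products above and the reciprocals
  of those below are bounded.\<close>

lemma level_gf_summable:
  fixes a b z z' q :: complex
  assumes "q \<noteq> 0" "norm q < 1" "norm (z * q) < 1" "norm (z' * q) < 1"
    and "a \<noteq> 0" "b \<noteq> 0" "norm (a * b * q\<^sup>2) < 1"
  shows "(\<lambda>t. norm (level_gf a b z z' q t)) summable_on UNIV"
proof -
  define p where "p = q\<^sup>2"
  have p: "norm p < 1"
    using assms by (simp add: p_def norm_power power_less_one_iff)
  obtain M1 where M1: "M1 > 0" "\<And>n. norm (qpoch_fin (- q / a) p n) \<le> M1"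
    using qpoch_fin_bounded[OF p] by blast
  obtain M2 where M2: "M2 > 0" "\<And>n. norm (qpoch_fin (- q / b) p n) \<le> M2"
    using qpoch_fin_bounded[OF p] by blast
  obtain M3 where M3: "M3 > 0" "\<And>n. norm (inverse (qpoch_fin (z * q) p n)) \<le> M3"
    using inverse_qpoch_fin_bounded[OF p one_minus_power_nonzero[OF p assms(3)]] by blast
  obtain M4 where M4: "M4 > 0" "\<And>n. norm (inverse (qpoch_fin (z' * q) p n)) \<le> M4"
    using inverse_qpoch_fin_bounded[OF p one_minus_power_nonzero[OF p assms(4)]] by blast
  define r where "r = norm (a * b * p)"
  have "(\<lambda>t. M1 * M2 * M3 * M4 * r ^ t) summable_on UNIV"
    using assms(7) by (intro summable_on_cmult_right summable_on_UNIV_nonneg_real_iff[THEN iffD2] summable_geometric)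
       (auto simp: r_def p_def)
  thus ?thesis
  proof (rule summable_on_comparison_test)
    fix t
    have "level_gf a b z z' q t = qpoch_fin (- q / a) p t * qpoch_fin (- q / b) p t
        * inverse (qpoch_fin (z * q) p (Suc t)) * inverse (qpoch_fin (z' * q) p (Suc t)) * ((a * b * p) ^ t * q)"
      unfolding level_gf_eq[OF assms(5,6)] p_def[symmetric] odd_power_eq
      by (simp add: divide_inverse power_mult_distrib mult_ac)
    hence "norm (level_gf a b z z' q t) = norm (qpoch_fin (- q / a) p t) * norm (qpoch_fin (- q / b) p t)
        * norm (inverse (qpoch_fin (z * q) p (Suc t))) * norm (inverse (qpoch_fin (z' * q) p (Suc t)))
        * (r ^ t * norm q)"
      unfolding r_def by (simp only: norm_mult norm_power)
    also have "\<dots> \<le> M1 * M2 * M3 * M4 * (r ^ t * 1)"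
      using assms(2) by (intro mult_mono M1(2) M2(2) M3(2) M4(2) order_refl mult_nonneg_nonneg norm_ge_zero
          zero_le_power M1(1)[THEN less_imp_le] M2(1)[THEN less_imp_le] M3(1)[THEN less_imp_le]
          M4(1)[THEN less_imp_le]) (auto simp: r_def)
    finally show "norm (level_gf a b z z' q t) \<le> M1 * M2 * M3 * M4 * r ^ t"
      by simp
  qed auto
qed

text \<open>\<open>bound\<close> recovers the level of a symbol, so the levels are disjoint and
  tagging with \<open>t\<close> is a mere relabelling.\<close>

lemma has_sum_durfee_levels:
  fixes f :: "odd_durfee \<Rightarrow> 'a :: topological_comm_monoid_add"
  shows "((\<lambda>(t, D). f D) has_sum s) (SIGMA t:UNIV. durfee_level t) \<longleftrightarrow> (f has_sum s) (\<Union>t. durfee_level t)"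
  by (rule has_sum_reindex_bij_witness[of _ "\<lambda>D. (bound D, D)" snd]) (auto simp: durfee_level_def)

lemma durfee_weight_norm_summable:
  fixes a b q :: complex and R :: real
  assumes "q \<noteq> 0" "norm q < 1" "R > 0" "R * norm q < 1"
    and "a \<noteq> 0" "b \<noteq> 0" "norm (a * b * q\<^sup>2) < 1"
  shows "durfee_weight (norm a) (norm b) R R (norm q) summable_on (\<Union>t. durfee_level t)"
proof -
  define g where "g = level_gf (norm a) (norm b) R R (norm q)"
  \<comment> \<open>the generating function at the moduli is its own majorant\<close>
  have lev: "(durfee_weight (norm a) (norm b) R R (norm q) has_sum g t) (durfee_level t)" for t
    unfolding g_def using assms by (intro durfee_level_has_sum) (auto simp: norm_mult)
  have nonneg: "durfee_weight (norm a) (norm b) R R (norm q) D \<ge> 0" for D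
    using assms(3) by (simp add: durfee_weight_def durfee_monomial_def)
  have "g t \<ge> 0" for t
    by (rule has_sum_nonneg[OF lev nonneg])
  \<comment> \<open>The estimate \<open>level_gf_summable\<close> lives over the complex numbers; a
    nonnegative real level sum is the norm of its complex copy.\<close>
  moreover have "of_real (g t)
      = level_gf (of_real (norm a)) (of_real (norm b)) (of_real R) (of_real R) (of_real (norm q) :: complex) t" for t
    by (simp add: g_def level_gf_def)
  ultimately have "g t = norm (level_gf (of_real (norm a)) (of_real (norm b)) (of_real R) (of_real R)
      (of_real (norm q) :: complex) t)" for t
    by (metis abs_of_nonneg norm_of_real)
  hence g: "g = (\<lambda>t. norm (level_gf (of_real (norm a)) (of_real (norm b)) (of_real R) (of_real R)
      (of_real (norm q) :: complex) t))"
    by (rule ext)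
  have "g summable_on UNIV"
    unfolding g using assms by (intro level_gf_summable) (auto simp: norm_mult norm_power)
  hence "(\<lambda>(t, D). durfee_weight (norm a) (norm b) R R (norm q) D) summable_on (SIGMA t:UNIV. durfee_level t)"
    by (intro summable_on_SigmaI[where g = g]) (use lev nonneg in auto)
  thus ?thesis
    unfolding summable_on_def has_sum_durfee_levels .
qed

text \<open>At \<open>z' = 1 / z\<close> each level sum is a summand of \<open>No\<close>. The
  second claim supplies the bound, uniform in \<open>z\<close>, that termwise differentiation
  needs.\<close>

theorem durfee_weight_has_sum_No:
  fixes a b q z :: complex and R :: real
  assumes "q \<noteq> 0" "norm q < 1" "R > 1" "R * norm q < 1"
    and "a \<noteq> 0" "b \<noteq> 0" "norm (a * b * q\<^sup>2) < 1" and z: "z \<in> annulus R"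
  shows "(durfee_weight a b z (1 / z) q has_sum No a b z q) (\<Union>t. durfee_level t)"
    and "norm (durfee_weight a b z (1 / z) q D) \<le> durfee_weight (norm a) (norm b) R R (norm q) D"
proof -
  have zq: "norm (z * q) < 1" "norm (1 / z * q) < 1" "z \<noteq> 0"
    using annulus_bounds(1)[OF z assms(3)] annulus_bounds(2,3)[OF z assms(3), of q] assms(4) by auto
  show le: "norm (durfee_weight a b z (1 / z) q D) \<le> durfee_weight (norm a) (norm b) R R (norm q) D" for D
  proof -
    have "norm z \<le> R" "norm (1 / z) \<le> R"
      using z zq(3) by (auto simp: annulus_def norm_divide field_simps)
    hence "norm z ^ size (top_row D) * norm (1 / z) ^ size (bot_row D)
        \<le> R ^ size (top_row D) * R ^ size (bot_row D)"
      using assms(3) by (intro mult_mono power_mono) auto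
    thus ?thesis
      unfolding durfee_weight_def durfee_monomial_def norm_mult norm_power
      by (intro mult_left_mono) auto
  qed
  have "(\<lambda>D. norm (durfee_weight a b z (1 / z) q D)) summable_on (\<Union>t. durfee_level t)"
    by (rule summable_on_comparison_test[OF durfee_weight_norm_summable[of q R a b]]) (use assms le in auto)
  hence "durfee_weight a b z (1 / z) q summable_on (\<Union>t. durfee_level t)"
    by (rule abs_summable_summable)
  then obtain s where s: "(durfee_weight a b z (1 / z) q has_sum s) (\<Union>t. durfee_level t)"
    by (auto simp: summable_on_def)
  hence "((\<lambda>(t, D). durfee_weight a b z (1 / z) q D) has_sum s) (SIGMA t:UNIV. durfee_level t)"
    by (simp only: has_sum_durfee_levels)
  hence "(level_gf a b z (1 / z) q has_sum s) UNIV"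
    by (rule has_sum_SigmaD) (use durfee_level_has_sum[OF assms(2) zq(1,2)] in simp)
  hence "s = (\<Sum>t. level_gf a b z (1 / z) q t)"
    using has_sum_imp_sums sums_unique by blast
  also have "\<dots> = No a b z q"
  proof -
    have p: "q\<^sup>2 \<noteq> 0" "norm (q\<^sup>2) < 1"
      using assms by (simp_all add: norm_power power_less_one_iff)
    have "int n + 1 = int (Suc n)" for n
      by simp
    moreover have "1 / z * q = q / z"
      by simp
    ultimately show ?thesis
      unfolding No_def level_gf_eq[OF assms(5,6)] by (simp only: qpoch_of_nat[OF p])
  qed
  finally show "(durfee_weight a b z (1 / z) q has_sum No a b z q) (\<Union>t. durfee_level t)"
    using s by simp
qed

section \<open>Symmetrized rank moments\<close>

lemma of_real_gbinomial: "of_real (a gchoose k) = (of_real a gchoose k :: complex)"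
  by (simp add: gbinomial_prod_rev)

text \<open>Termwise differentiation over symbols: on the annulus |z| and 1/|z| are both below R, so
  R^k times the weight at the moduli is a summable majorant.\<close>

lemma durfee_moment_has_sum:
  fixes a b q :: complex
  assumes "q \<noteq> 0" "norm q < 1" and "a \<noteq> 0" "b \<noteq> 0" "norm (a * b * q\<^sup>2) < 1"
  shows "((\<lambda>D. durfee_monomial a b q D * (of_int (durfee_rank D + int k) gchoose (2 * k)))
           has_sum No_deriv k a b q) (\<Union>t. durfee_level t)"
proof -
  obtain R where R: "R > 1" "R * norm q < 1"
    using radius_exists[OF assms(1,2)] .
  define f where "f D z = durfee_monomial a b q D * z powi (durfee_rank D + int k)" for D z
  have f: "f D w = w ^ k * durfee_weight a b w (1 / w) q D" if "w \<in> annulus R" for D w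
  proof -
    have "w \<noteq> 0"
      by (rule annulus_bounds(1)[OF that R(1)])
    hence "w powi (durfee_rank D + int k) = w ^ size (top_row D) * (1 / w) ^ size (bot_row D) * w ^ k"
      by (simp add: durfee_rank_def power_int_add power_int_diff power_divide)
    thus ?thesis
      by (simp add: f_def durfee_weight_def)
  qed
  have "((\<lambda>D. (deriv ^^ (2 * k)) (f D) 1) has_sum (deriv ^^ (2 * k)) (\<lambda>z. z ^ k * No a b z q) 1) (\<Union>t. durfee_level t)"
  proof (rule has_sum_higher_deriv[OF open_annulus[of R]])
    show "1 \<in> annulus R"
      using R by (simp add: annulus_def)
    show "f D holomorphic_on annulus R" for D
      unfolding f_def using annulus_bounds(1)[OF _ R(1)] by (intro holomorphic_intros) auto
    show "norm (f D w) \<le> R ^ k * durfee_weight (norm a) (norm b) R R (norm q) D" if "w \<in> annulus R" for D w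
      unfolding f[OF that] norm_mult norm_power
      by (intro mult_mono power_mono durfee_weight_has_sum_No(2)[OF assms(1,2) R assms(3-5) that])
         (use that R in \<open>auto simp: annulus_def\<close>)
    show "(\<lambda>D. R ^ k * durfee_weight (norm a) (norm b) R R (norm q) D) summable_on (\<Union>t. durfee_level t)"
      using R assms by (intro summable_on_cmult_right durfee_weight_norm_summable) auto
    show "((\<lambda>D. f D w) has_sum w ^ k * No a b w q) (\<Union>t. durfee_level t)" if "w \<in> annulus R" for w
      unfolding f[OF that]
      by (intro has_sum_cmult_right durfee_weight_has_sum_No(1)[OF assms(1,2) R assms(3-5) that])
  qed
  hence "((\<lambda>D. (deriv ^^ (2 * k)) (f D) 1 * inverse (fact (2 * k))) has_sum
      (deriv ^^ (2 * k)) (\<lambda>z. z ^ k * No a b z q) 1 * inverse (fact (2 * k))) (\<Union>t. durfee_level t)"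
    by (rule has_sum_cmult_left)
  moreover have "(deriv ^^ (2 * k)) (f D) 1 * inverse (fact (2 * k))
      = durfee_monomial a b q D * (of_int (durfee_rank D + int k) gchoose (2 * k))" for D
  proof -
    have "(deriv ^^ (2 * k)) (f D) 1
        = durfee_monomial a b q D * (deriv ^^ (2 * k)) (\<lambda>z. z powi (durfee_rank D + int k)) 1"
      unfolding f_def by (rule higher_deriv_cmult[where A = "- {0}"]) (auto intro!: holomorphic_intros)
    thus ?thesis
      by (simp add: higher_deriv_power_int)
  qed
  ultimately show ?thesis
    by (simp only: No_deriv_def divide_inverse)
qed

text \<open>Only ranks of actual symbols contribute, so the sum over \<open>m\<close> is finite, and
  writing each count as a sum over symbols of that rank ungroups it. The shift is (2k) div 2 =
  k.\<close>

lemma eta_eq_sum: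
  "eta (2 * k) r s n
     = (\<Sum>D | D \<in> odd_durfee_symbols n \<and> missing (bound D) (lam D) = r \<and> missing (bound D) (mu D) = s.
          of_int (durfee_rank D + int k) gchoose (2 * k))"
proof -
  define F where "F = {D. D \<in> odd_durfee_symbols n \<and> missing (bound D) (lam D) = r \<and> missing (bound D) (mu D) = s}"
  have "finite F"
    unfolding F_def using finite_odd_durfee_symbols[of n] by simp
  define h :: "int \<Rightarrow> real" where "h m = of_int (m + int k) gchoose (2 * k)" for m
  have count: "durfee_count r s m n = card {D \<in> F. durfee_rank D = m}" for m
    by (simp add: durfee_count_def F_def conj_ac)
  have "eta (2 * k) r s n = (\<Sum>\<^sub>\<infinity>m. h m * real (card {D \<in> F. durfee_rank D = m}))"
    by (simp add: eta_def count h_def)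
  also have "\<dots> = (\<Sum>\<^sub>\<infinity>m\<in>durfee_rank ` F. h m * real (card {D \<in> F. durfee_rank D = m}))"
  proof (rule infsum_cong_neutral)
    fix m assume "m \<in> UNIV - durfee_rank ` F"
    hence "{D \<in> F. durfee_rank D = m} = {}"
      by auto
    thus "h m * real (card {D \<in> F. durfee_rank D = m}) = 0"
      by (simp only: card.empty of_nat_0 mult_zero_right)
  qed auto
  also have "\<dots> = (\<Sum>m\<in>durfee_rank ` F. \<Sum>D | D \<in> F \<and> durfee_rank D = m. h (durfee_rank D))"
    using \<open>finite F\<close> by (simp add: mult.commute)
  also have "\<dots> = (\<Sum>D\<in>F. h (durfee_rank D))"
    by (rule sum.image_gen[OF \<open>finite F\<close>, symmetric])
  finally show ?thesis
    by (simp add: F_def h_def)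
qed

text \<open>Group the symbols by their exponents of \<open>a\<close>, \<open>b\<close> and
  \<open>q\<close>: the monomial is constant on each fibre, and a fibre is finite because its
  symbols share the size \<open>n\<close>.\<close>

theorem eta_has_sum:
  fixes a b q :: complex
  assumes "q \<noteq> 0" "norm q < 1" and "a \<noteq> 0" "b \<noteq> 0" "norm (a * b * q\<^sup>2) < 1"
  shows "((\<lambda>(r, s, n). complex_of_real (eta (2 * k) r s n) * a ^ r * b ^ s * q ^ n)
            has_sum No_deriv k a b q) UNIV"
proof -
  define V where "V = (\<Union>t. durfee_level t)"
  define key where "key D = (missing (bound D) (lam D), missing (bound D) (mu D), durfee_size D)" for D
  define g where "g D = durfee_monomial a b q D * (of_int (durfee_rank D + int k) gchoose (2 * k))" for D
  have "((\<lambda>(x, D). g D) has_sum No_deriv k a b q) (SIGMA x:UNIV. {D \<in> V. key D = x})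
      \<longleftrightarrow> (g has_sum No_deriv k a b q) V"
    by (rule has_sum_reindex_bij_witness[of _ "\<lambda>D. (key D, D)" snd]) auto
  hence "((\<lambda>(x, D). g D) has_sum No_deriv k a b q) (SIGMA x:UNIV. {D \<in> V. key D = x})"
    using durfee_moment_has_sum[OF assms] by (simp add: V_def g_def[abs_def])
  thus ?thesis
  proof (rule has_sum_SigmaD)
    fix x :: "nat \<times> nat \<times> nat"
    obtain r s n where x: "x = (r, s, n)"
      by (cases x) auto
    define F where "F = {D. D \<in> odd_durfee_symbols n \<and> missing (bound D) (lam D) = r \<and> missing (bound D) (mu D) = s}"
    have F: "{D \<in> V. key D = x} = F" "finite F"
      by (auto simp: F_def V_def key_def x odd_durfee_symbols_eq
            intro: finite_subset[OF _ finite_odd_durfee_symbols[of n, unfolded odd_durfee_symbols_eq]])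
    have "(\<Sum>D\<in>F. g D) = (\<Sum>D\<in>F. a ^ r * b ^ s * q ^ n * of_real (of_int (durfee_rank D + int k) gchoose (2 * k)))"
      by (rule sum.cong) (auto simp: F_def g_def durfee_monomial_def odd_durfee_symbols_eq of_real_gbinomial)
    also have "\<dots> = complex_of_real (eta (2 * k) r s n) * a ^ r * b ^ s * q ^ n"
      unfolding eta_eq_sum F_def[symmetric] by (simp add: sum_distrib_left mult_ac)
    finally have "(g has_sum complex_of_real (eta (2 * k) r s n) * a ^ r * b ^ s * q ^ n) F"
      using F(2) by (intro has_sum_finiteI) simp_all
    thus "((\<lambda>D. case (x, D) of (x, D) \<Rightarrow> g D) has_sum
        (case x of (r, s, n) \<Rightarrow> complex_of_real (eta (2 * k) r s n) * a ^ r * b ^ s * q ^ n)) {D \<in> V. key D = x}"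
      by (simp add: F(1)) (simp add: x)
  qed
qed

theorem theorem2p1:
  fixes a b q :: complex and k :: nat
  assumes "k \<ge> 1"
    and "q \<noteq> 0" and "norm q < 1"
    and "a \<noteq> 0" and "b \<noteq> 0"
    and "norm (a * b * q\<^sup>2) < 1"
    and "\<And>j::nat. 1 + a * q ^ (2 * j + 1) \<noteq> 0"
    and "\<And>j::nat. 1 + b * q ^ (2 * j + 1) \<noteq> 0"
  shows "((\<lambda>(r, s, n). complex_of_real (eta (2 * k) r s n) * a ^ r * b ^ s * q ^ n)
            has_sum No_deriv k a b q) (UNIV :: (nat \<times> nat \<times> nat) set)
       \<and> ((\<lambda>n::int. qpoch (- q / a) (q\<^sup>2) n * qpoch (- q / b) (q\<^sup>2) n
              * (- (a * b)) powi n * q powi (n\<^sup>2 + 3 * n + 1 + int k * (2 * n + 1))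
            / ((1 - q powi (2 * n + 1)) ^ (2 * k + 1)
               * (qpoch (- a * q) (q\<^sup>2) (n + 1) * qpoch (- b * q) (q\<^sup>2) (n + 1))))
            summable_on UNIV)
       \<and> No_deriv k a b q =
           qpoch_inf (- a * q) (q\<^sup>2) * qpoch_inf (- b * q) (q\<^sup>2)
           / (qpoch_inf (q\<^sup>2) (q\<^sup>2) * qpoch_inf (a * b * q\<^sup>2) (q\<^sup>2))
           * (\<Sum>\<^sub>\<infinity>n::int. qpoch (- q / a) (q\<^sup>2) n * qpoch (- q / b) (q\<^sup>2) n
              * (- (a * b)) powi n * q powi (n\<^sup>2 + 3 * n + 1 + int k * (2 * n + 1))
            / ((1 - q powi (2 * n + 1)) ^ (2 * k + 1)
               * (qpoch (- a * q) (q\<^sup>2) (n + 1) * qpoch (- b * q) (q\<^sup>2) (n + 1))))"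
proof -
  have nz: "1 + a * q ^ (2 * j + 1) \<noteq> 0" "1 + b * q ^ (2 * j + 1) \<noteq> 0" for j
    using assms(7,8) by blast+
  show ?thesis
    using eta_has_sum[OF assms(2-6), of k] No_deriv_bilateral[OF assms(2-6) nz, of k]
    unfolding bilateral_term_def[abs_def] by blast
qed

end
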